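(* There are absolute constants $c>0$ and $r_0\in\mathbb{N}$ such that, for every integer $r\geq r_0$ and every sequence $(x_n)_{n\geq1}$ of distinct points on the circle $\mathbb{T}=\mathbb{R}/\mathbb{Z}$, \[ \limsup_{n\to\infty}\bigl(nM_n^{(r)}-r\bigr)\geq c\sqrt{\log r},\qquad \limsup_{n\to\infty}\bigl(r-nm_n^{(r)}\bigr)\geq c\sqrt{\log r}, \] and \[ \limsup_{n\to\infty}\frac{M_n^{(r)}}{m_n^{(r)}}\geq 1+\frac{\log r}{100\,r}. \]
   Context: $\mathbb{T}=\mathbb{R}/\mathbb{Z}$ is the circle of total length $1$, and $\log$ is the natural logarithm. Given a sequence $(x_n)_{n\ge1}$ of distinct points on $\mathbb{T}$, the first $n$ points $x_1,\dots,x_n$ cut the circle into $n$ arcs; their lengths, written in cyclic order, are the gap lengths $g_1^{(n)},\ldots,g_n^{(n)}$. For an integer $r\ge1$ and $n\geq r$, an $r$-span is the total length of $r$ consecutive gaps, and \[ M_n^{(r)}=\max_i\sum_{j=0}^{r-1}g_{i+j}^{(n)},\qquad m_n^{(r)}=\min_i\sum_{j=0}^{r-1}g_{i+j}^{(n)}, \] with indices taken cyclically (modulo $n$). *)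

theory Defs
  imports Complex_Main "HOL-Library.Extended_Real" "HOL-Library.Liminf_Limsup"
begin

definition circle_rel :: "real \<Rightarrow> real \<Rightarrow> bool" where
  "circle_rel s t \<longleftrightarrow> s - t \<in> \<int>"

quotient_type circle = real / circle_rel
proof (rule equivpI)
  show "reflp circle_rel"
    by (simp add: reflp_def circle_rel_def)
  show "symp circle_rel"
    unfolding symp_def circle_rel_def by (metis Ints_minus minus_diff_eq)
  show "transp circle_rel"
    unfolding transp_def circle_rel_def by (metis Ints_add diff_add_cancel add_diff_eq)
qed

text \<open>The unique representative in \<open>[0, 1)\<close>.\<close>

lift_definition coord :: "circle \<Rightarrow> real" is frac
proof -
  fix s t :: real
  assume "circle_rel s t"
  then obtain k :: int where "s = t + of_int k"
    unfolding circle_rel_def by (metis Ints_cases add.commute diff_add_cancel)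
  then show "frac s = frac t"
    by (simp add: frac_def)
qed

text \<open>Sequences are indexed from \<open>1\<close>; the value \<open>x 0\<close> is never used.\<close>

definition cut_points :: "(nat \<Rightarrow> circle) \<Rightarrow> nat \<Rightarrow> real list" where
  "cut_points x n = sorted_list_of_set (coord ` x ` {1..n})"

text \<open>
  For distinct points, \<open>cut_points x n\<close> has length \<open>n\<close>. Gaps are numbered from \<open>0\<close> to \<open>n - 1\<close>,
  with the index read modulo \<open>n\<close>; gap \<open>n - 1\<close> is the arc that runs through the point \<open>0\<close> of the
  circle from the last cut point back to the first one (the whole circle when \<open>n = 1\<close>).
\<close>

definition gap :: "(nat \<Rightarrow> circle) \<Rightarrow> nat \<Rightarrow> nat \<Rightarrow> real" where
  "gap x n i =
    (let p = cut_points x n; k = i mod n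
     in if Suc k < n then p ! Suc k - p ! k else 1 + p ! 0 - p ! k)"

definition span_length :: "(nat \<Rightarrow> circle) \<Rightarrow> nat \<Rightarrow> nat \<Rightarrow> nat \<Rightarrow> real" where
  "span_length x r n i = (\<Sum>j<r. gap x n (i + j))"

text \<open>Meaningful for \<open>1 \<le> r \<le> n\<close>.\<close>

definition max_span :: "(nat \<Rightarrow> circle) \<Rightarrow> nat \<Rightarrow> nat \<Rightarrow> real" where
  "max_span x r n = Max (span_length x r n ` {..<n})"

definition min_span :: "(nat \<Rightarrow> circle) \<Rightarrow> nat \<Rightarrow> nat \<Rightarrow> real" where
  "min_span x r n = Min (span_length x r n ` {..<n})"

end

theory Submission
  imports Defs "HOL-Analysis.Analysis" "HOL-Real_Asymp.Real_Asymp"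
begin

text \<open>
  Fix \<open>\<rho> = r \<plusminus> s\<close> with \<open>s = ln r / 100\<close>. If all spans at time \<open>n\<close> are at most \<open>(r + s) / n\<close> (or at
  least \<open>(r - s) / n\<close>), then the number of points among the first \<open>n\<close> in a window \<open>(a, a + \<rho> / n]\<close>
  deviates from \<open>\<rho>\<close> by at most \<open>s\<close> in one direction. This one-sided bound is refuted as follows.
  The deviation is \<open>G n a = F n (a + \<rho> / n) - F n a\<close>, where \<open>F n\<close> is a sum of sawtooth functions,
  and it has mean \<open>0\<close> over the circle. As in Schmidt's theorem, one shows that
  the mean over \<open>a\<close> of the maximum of \<open>G n a\<close> over \<open>n\<close> in a time interval grows by a constant each
  time the interval is lengthened by the factor \<open>4\<close>: between two consecutive points born in the
  interval, \<open>- F n a\<close> is affine in \<open>a\<close> with slope the elapsed time, so the maxima over the first and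
  over the last quarter differ substantially in the mean.

  The term \<open>F n (a + \<rho> / n)\<close> must not interfere. It is averaged over short blocks of \<open>n\<close>, during
  which \<open>a + \<rho> / n\<close> slides; the average varies little with \<open>a\<close> if \<open>F n\<close> has small
  increments over the sliding distance. These increments are controlled in the mean by transporting
  an interval by many windows at one time and back at a slightly different time, which moves it by
  its own length at each step until a whole window is covered. This works for about
  \<open>ln r\<close> scales. The resulting bound on \<open>n M - r\<close> is of order \<open>ln r\<close> and implies
  the bound on the ratio, because \<open>n m \<le> r\<close>.
\<close>

section \<open>Bounded Borel functions and their integrals\<close>

text \<open>The class is closed under sums, maxima, absolute values and translations and lies in the
  functions integrable on compact intervals, so integrability below follows from the form of the
  integrand.\<close>

definition bdd_borel :: "(real \<Rightarrow> real) \<Rightarrow> bool" where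
  "bdd_borel f \<longleftrightarrow> f \<in> borel_measurable borel \<and> (\<exists>B. \<forall>x. \<bar>f x\<bar> \<le> B)"

lemma bdd_borelI: "f \<in> borel_measurable borel \<Longrightarrow> (\<And>x. \<bar>f x\<bar> \<le> B) \<Longrightarrow> bdd_borel f"
  unfolding bdd_borel_def by blast

lemma bdd_borel_const [simp, intro]: "bdd_borel (\<lambda>x. c)"
  by (rule bdd_borelI[where B = "\<bar>c\<bar>"]) auto

lemma bdd_borel_add [simp, intro]:
  assumes "bdd_borel f" "bdd_borel g" shows "bdd_borel (\<lambda>x. f x + g x)"
proof -
  obtain B C where "\<And>x. \<bar>f x\<bar> \<le> B" "\<And>x. \<bar>g x\<bar> \<le> C"
    using assms unfolding bdd_borel_def by blast
  then have "\<bar>f x + g x\<bar> \<le> B + C" for x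
    by (meson abs_triangle_ineq add_mono order_trans)
  with assms show ?thesis
    unfolding bdd_borel_def by (intro conjI exI[of _ "B + C"]) auto
qed

lemma bdd_borel_cmult [simp, intro]:
  assumes "bdd_borel f" shows "bdd_borel (\<lambda>x. c * f x)"
proof -
  obtain B where "\<And>x. \<bar>f x\<bar> \<le> B"
    using assms unfolding bdd_borel_def by blast
  then have "\<bar>c * f x\<bar> \<le> \<bar>c\<bar> * B" for x
    by (simp add: abs_mult mult_left_mono)
  with assms show ?thesis
    unfolding bdd_borel_def by (intro conjI exI[of _ "\<bar>c\<bar> * B"]) auto
qed

lemma bdd_borel_minus [simp, intro]: "bdd_borel f \<Longrightarrow> bdd_borel (\<lambda>x. - f x)"
  using bdd_borel_cmult[of f "-1"] by simp

lemma bdd_borel_diff [simp, intro]: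
  "bdd_borel f \<Longrightarrow> bdd_borel g \<Longrightarrow> bdd_borel (\<lambda>x. f x - g x)"
  using bdd_borel_add[of f "\<lambda>x. - g x"] by auto

lemma bdd_borel_divide [simp, intro]: "bdd_borel f \<Longrightarrow> bdd_borel (\<lambda>x. f x / c)"
  using bdd_borel_cmult[of f "1 / c"] by simp

lemma bdd_borel_abs [simp, intro]: "bdd_borel f \<Longrightarrow> bdd_borel (\<lambda>x. \<bar>f x\<bar>)"
  unfolding bdd_borel_def by auto

lemma bdd_borel_max [simp, intro]:
  assumes "bdd_borel f" "bdd_borel g" shows "bdd_borel (\<lambda>x. max (f x) (g x))"
proof -
  have "(\<lambda>x. max (f x) (g x)) = (\<lambda>x. (1/2) * (f x + g x + \<bar>f x - g x\<bar>))"
    by (auto simp: max_def abs_if field_simps)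
  moreover have "bdd_borel (\<lambda>x. (1/2) * (f x + g x + \<bar>f x - g x\<bar>))"
    using assms by (intro bdd_borel_cmult bdd_borel_add bdd_borel_abs bdd_borel_diff)
  ultimately show ?thesis by metis
qed

lemma bdd_borel_sum [simp, intro]:
  "(\<And>i. i \<in> I \<Longrightarrow> bdd_borel (f i)) \<Longrightarrow> bdd_borel (\<lambda>x. \<Sum>i\<in>I. f i x)"
  by (induction I rule: infinite_finite_induct) auto

lemma bdd_borel_compose:
  "bdd_borel f \<Longrightarrow> g \<in> borel_measurable borel \<Longrightarrow> bdd_borel (\<lambda>x. f (g x))"
  unfolding bdd_borel_def using measurable_compose by blast

lemma bdd_borel_shift [simp, intro]: "bdd_borel f \<Longrightarrow> bdd_borel (\<lambda>x. f (x + c))"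
  by (rule bdd_borel_compose) auto

lemma bdd_borel_integrable [simp, intro]:
  assumes "bdd_borel f" shows "f integrable_on {a..b}"
proof -
  obtain B where m: "f \<in> borel_measurable borel" and B: "\<And>x. \<bar>f x\<bar> \<le> B"
    using assms unfolding bdd_borel_def by blast
  have "set_integrable lborel {a..b} f"
    unfolding set_integrable_def
    by (rule integrableI_bounded_set_indicator[where B = B]) (use m B in \<open>auto simp: emeasure_lborel_Icc_eq\<close>)
  then show ?thesis by (rule set_borel_integral_eq_integral)
qed

lemma integral_periodic_shift:
  fixes f :: "real \<Rightarrow> real"
  assumes f: "bdd_borel f" and per: "\<And>x. f (x + 1) = f x"
  shows "integral {0..1} (\<lambda>x. f (x + c)) = integral {0..1} f"
proof -
  have step: "f (x + of_nat n) = f x" for x n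
  proof (induction n)
    case (Suc n)
    then show ?case using per[of "x + of_nat n"] by (simp add: ac_simps)
  qed simp
  have int: "f (x + of_int k) = f x" for x k
  proof (cases "0 \<le> k")
    case True
    then show ?thesis using step[of x "nat k"] by simp
  next
    case False
    then show ?thesis using step[of "x + of_int k" "nat (- k)"] by simp
  qed
  define d where "d = frac c"
  have d: "0 \<le> d" "d < 1" by (auto simp: d_def frac_lt_1)
  have "f (x + c) = f (x + d)" for x
    using int[of "x + d" "\<lfloor>c\<rfloor>"] by (simp add: d_def frac_def)
  then have "integral {0..1} (\<lambda>x. f (x + c)) = integral {0..1} (\<lambda>x. f (x + d))" by simp
  also have "\<dots> = integral {d..1 + d} f"
    using integral_shift_real_ivl[of d d "1 + d" f] by simp
  also have "\<dots> = integral {d..1} f + integral {1..1 + d} f"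
    using d f by (intro Henstock_Kurzweil_Integration.integral_combine[symmetric]) auto
  also have "integral {1..1 + d} f = integral {0..d} (\<lambda>x. f (x + 1))"
    using integral_shift_real_ivl[of 1 1 "1 + d" f] by simp
  also have "\<dots> = integral {0..d} f" by (simp add: per)
  also have "integral {d..1} f + integral {0..d} f = integral {0..1} f"
    using Henstock_Kurzweil_Integration.integral_combine[of 0 d 1 f] d f by auto
  finally show ?thesis .
qed

text \<open>Only increments of \<open>D\<close> will be under control, not its values. If
  \<open>D\<close> changes much between two mirror points, then it cannot be small at both, which is
  the hypothesis \<open>pair\<close>. Folding the right half onto the left leaves the integral of g
  (u + v - 2 a) over the left half, which is g / 4 (v - u)^2. Being nonnegative, \<open>h\<close>
  may be charged on the whole interval.\<close>

lemma integral_reflect_pair: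
  assumes D: "bdd_borel D" and h: "bdd_borel h" and "u \<le> v"
    and h0: "\<And>a. 0 \<le> h a"
    and pair: "\<And>a. u < a \<Longrightarrow> a < (u + v) / 2 \<Longrightarrow> g * (u + v - 2 * a) - h a \<le> \<bar>D a\<bar> + \<bar>D (u + v - a)\<bar>"
  shows "g / 4 * (v - u)\<^sup>2 - integral {u..v} h \<le> integral {u..v} (\<lambda>a. \<bar>D a\<bar>)"
proof -
  define w where "w = (u + v) / 2"
  have w: "u \<le> w" "w \<le> v" using \<open>u \<le> v\<close> by (auto simp: w_def)
  have Dr: "bdd_borel (\<lambda>a. \<bar>D (u + v - a)\<bar>)"
    by (rule bdd_borel_abs, rule bdd_borel_compose[of D]) (use D in auto)
  have refl: "integral {w..v} (\<lambda>a. \<bar>D a\<bar>) = integral {u..w} (\<lambda>a. \<bar>D (u + v - a)\<bar>)"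
  proof -
    have "integral {w..v} (\<lambda>a. \<bar>D a\<bar>) = integral {-v..-w} (\<lambda>a. \<bar>D (- a)\<bar>)"
      using Henstock_Kurzweil_Integration.integral_reflect_real[of v w "\<lambda>a. \<bar>D a\<bar>"] by simp
    also have "\<dots> = integral {u..w} (\<lambda>a. \<bar>D (u + v - a)\<bar>)"
      using integral_shift_real_ivl[of "-v" "-(u+v)" "-w" "\<lambda>a. \<bar>D (- a)\<bar>"]
      by (simp add: w_def field_simps)
    finally show ?thesis .
  qed
  have aff: "((\<lambda>a. g * (u + v - 2 * a)) has_integral g / 4 * (v - u)\<^sup>2) {u..w}"
  proof -
    have "((\<lambda>a. g * (u + v - 2 * a)) has_integral
       (g * ((u + v) * w - w\<^sup>2) - g * ((u + v) * u - u\<^sup>2))) {u..w}"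
      using w(1) by (intro fundamental_theorem_of_calculus)
        (auto intro!: derivative_eq_intros simp: has_real_derivative_iff_has_vector_derivative[symmetric])
    moreover have "g * ((u + v) * w - w\<^sup>2) - g * ((u + v) * u - u\<^sup>2) = g / 4 * (v - u)\<^sup>2"
      by (simp add: w_def power2_eq_square field_simps)
    ultimately show ?thesis by simp
  qed
  have "g / 4 * (v - u)\<^sup>2 - integral {u..w} h = integral {u..w} (\<lambda>a. g * (u + v - 2 * a) - h a)"
    by (subst integral_diff[OF has_integral_integrable[OF aff] bdd_borel_integrable[OF h]])
      (simp only: integral_unique[OF aff])
  also have "\<dots> = integral {u<..<w} (\<lambda>a. g * (u + v - 2 * a) - h a)"
    by (simp add: integral_open_interval_real)
  also have "\<dots> \<le> integral {u<..<w} (\<lambda>a. \<bar>D a\<bar> + \<bar>D (u + v - a)\<bar>)"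
    using aff h D Dr pair
    by (intro integral_le) (auto simp: integrable_on_Icc_iff_Ioo[symmetric] w_def
        intro!: integrable_diff integrable_add has_integral_integrable[OF aff[unfolded w_def]])
  also have "\<dots> = integral {u..w} (\<lambda>a. \<bar>D a\<bar> + \<bar>D (u + v - a)\<bar>)"
    by (simp add: integral_open_interval_real)
  also have "\<dots> = integral {u..w} (\<lambda>a. \<bar>D a\<bar>) + integral {w..v} (\<lambda>a. \<bar>D a\<bar>)"
    using D Dr by (simp add: integral_add refl bdd_borel_integrable)
  also have "\<dots> = integral {u..v} (\<lambda>a. \<bar>D a\<bar>)"
    using D w by (intro Henstock_Kurzweil_Integration.integral_combine) auto
  finally have 1: "g / 4 * (v - u)\<^sup>2 - integral {u..w} h \<le> integral {u..v} (\<lambda>a. \<bar>D a\<bar>)" .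
  have "integral {u..v} h = integral {u..w} h + integral {w..v} h"
    using h w by (intro Henstock_Kurzweil_Integration.integral_combine[symmetric]) auto
  moreover have "0 \<le> integral {w..v} h"
    using h h0 by (intro integral_nonneg) auto
  ultimately show ?thesis using 1 by simp
qed

text \<open>A form of the Cauchy-Schwarz inequality: the gain c L^2 of a piece of length L is
  replaced by its tangent c (2 t L - t^2), which adds up over the pieces cut out by \<open>Z\<close>
  knowing only their number. The best t is the mean length of the pieces.\<close>

lemma integral_piecewise_lower:
  assumes f: "bdd_borel f" and h: "bdd_borel h" and "finite Z" and "0 \<le> c"
    and piece: "\<And>u v. a \<le> u \<Longrightarrow> u \<le> v \<Longrightarrow> v \<le> b \<Longrightarrow> {u<..<v} \<inter> Z = {} \<Longrightarrow>
      c * (v - u)\<^sup>2 - integral {u..v} h \<le> integral {u..v} f"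
    and "a \<le> b"
  shows "c * (2 * t * (b - a) - t\<^sup>2 * real (card (Z \<inter> {a<..<b}) + 1)) - integral {a..b} h
    \<le> integral {a..b} f"
  using piece \<open>a \<le> b\<close>
proof (induction "card (Z \<inter> {a<..<b})" arbitrary: a b rule: less_induct)
  case less
  show ?case
  proof (cases "Z \<inter> {a<..<b} = {}")
    case True
    have "c * (2 * t * (b - a) - t\<^sup>2) \<le> c * (b - a)\<^sup>2"
      using zero_le_power2[of "b - a - t"] \<open>0 \<le> c\<close>
      by (intro mult_left_mono) (auto simp: power2_eq_square algebra_simps)
    then show ?thesis using True less(2)[of a b] less(3) by (auto simp: Int_commute)
  next
    case False
    then obtain z where z: "z \<in> Z" "a < z" "z < b" by auto
    have split: "Z \<inter> {a<..<b} = insert z ((Z \<inter> {a<..<z}) \<union> (Z \<inter> {z<..<b}))"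
      using z by auto
    have "card (Z \<inter> {a<..<b}) = Suc (card ((Z \<inter> {a<..<z}) \<union> (Z \<inter> {z<..<b})))"
      unfolding split using \<open>finite Z\<close> by (subst card_insert_disjoint) auto
    also have "card ((Z \<inter> {a<..<z}) \<union> (Z \<inter> {z<..<b})) = card (Z \<inter> {a<..<z}) + card (Z \<inter> {z<..<b})"
      using \<open>finite Z\<close> by (intro card_Un_disjoint) auto
    finally have card: "card (Z \<inter> {a<..<b}) = Suc (card (Z \<inter> {a<..<z}) + card (Z \<inter> {z<..<b}))" .
    have I1: "c * (2 * t * (z - a) - t\<^sup>2 * real (card (Z \<inter> {a<..<z}) + 1)) - integral {a..z} h
      \<le> integral {a..z} f"
      by (rule less.hyps) (use card z less(2,3) in auto)
    have I2: "c * (2 * t * (b - z) - t\<^sup>2 * real (card (Z \<inter> {z<..<b}) + 1)) - integral {z..b} h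
      \<le> integral {z..b} f"
      by (rule less.hyps) (use card z less(2,3) in auto)
    have "integral {a..b} f = integral {a..z} f + integral {z..b} f"
         "integral {a..b} h = integral {a..z} h + integral {z..b} h"
      using f h z by (auto intro!: bdd_borel_integrable Henstock_Kurzweil_Integration.integral_combine[symmetric])
    with I1 I2 show ?thesis unfolding card by (simp add: algebra_simps)
  qed
qed

section \<open>Discrepancy of windows\<close>

text \<open>Up to an additive constant this is, on [0, 1), the number of points in (0, a] minus n a,
  extended periodically; see \<open>disc_diff\<close>.\<close>

definition disc :: "(nat \<Rightarrow> real) \<Rightarrow> nat \<Rightarrow> real \<Rightarrow> real" where
  "disc y n a = - (\<Sum>i=1..n. frac (a - y i))"

text \<open>The number of pairs \<open>i \<le> n\<close>, \<open>k \<in> \<int>\<close> with \<open>a < y i + k \<le> b\<close>.\<close>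

definition cnt :: "(nat \<Rightarrow> real) \<Rightarrow> nat \<Rightarrow> real \<Rightarrow> real \<Rightarrow> int" where
  "cnt y n a b = (\<Sum>i=1..n. \<lfloor>b - y i\<rfloor> - \<lfloor>a - y i\<rfloor>)"

definition wdisc :: "(nat \<Rightarrow> real) \<Rightarrow> real \<Rightarrow> nat \<Rightarrow> real \<Rightarrow> real" where
  "wdisc y \<rho> n a = disc y n (a + \<rho> / real n) - disc y n a"

lemma disc_periodic: "disc y n (a + 1) = disc y n a"
proof -
  have "frac (a + 1 - t) = frac (a - t)" for t :: real
    by (metis add_diff_eq add.commute diff_add_eq frac_1_eq)
  then show ?thesis by (simp add: disc_def)
qed

lemma bdd_borel_disc [simp, intro]: "bdd_borel (disc y n)"
proof -
  have "bdd_borel (\<lambda>a. frac (a - t))" for t :: real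
  proof (rule bdd_borelI[where B = 1])
    show "(\<lambda>a. frac (a - t)) \<in> borel_measurable borel"
      unfolding frac_def by (intro borel_measurable_diff measurable_compose[OF _ borel_measurable_real_floor]) auto
  qed (simp add: frac_lt_1 less_imp_le abs_of_nonneg)
  then have "bdd_borel (\<lambda>a. - (\<Sum>i=1..n. frac (a - y i)))" by (intro bdd_borel_minus bdd_borel_sum)
  then show ?thesis unfolding disc_def[abs_def] .
qed

lemma bdd_borel_disc_shift [simp, intro]: "bdd_borel (\<lambda>a. disc y n (a + c))"
  by (rule bdd_borel_shift) auto

lemma bdd_borel_wdisc [simp, intro]: "bdd_borel (wdisc y \<rho> n)"
  unfolding wdisc_def[abs_def] by auto

lemma disc_diff: "disc y n b - disc y n a = of_int (cnt y n a b) - real n * (b - a)"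
  unfolding disc_def cnt_def frac_def
  by (simp add: sum_subtractf sum_negf sum.distrib algebra_simps)

lemma cnt_mono:
  assumes "n \<le> n'" "a' \<le> a" "a \<le> b" "b \<le> b'" shows "cnt y n a b \<le> cnt y n' a' b'"
proof -
  have "cnt y n a b \<le> (\<Sum>i=1..n. \<lfloor>b' - y i\<rfloor> - \<lfloor>a' - y i\<rfloor>)"
    unfolding cnt_def using assms by (intro sum_mono diff_mono floor_mono) auto
  also have "\<dots> \<le> cnt y n' a' b'"
    unfolding cnt_def using assms by (intro sum_mono2) (auto intro!: floor_mono)
  finally show ?thesis .
qed

lemma cnt_nonneg: "a \<le> b \<Longrightarrow> 0 \<le> cnt y n a b"
  unfolding cnt_def by (intro sum_nonneg) (auto intro!: floor_mono)

text \<open>Later points can only raise the count, so an increment loses at most the growth of its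
  expected count.\<close>

lemma disc_increment_mono:
  assumes "n \<le> n'" "a \<le> b"
  shows "disc y n b - disc y n a \<le> disc y n' b - disc y n' a + (real n' - real n) * (b - a)"
proof -
  have "real_of_int (cnt y n a b) \<le> cnt y n' a b" using cnt_mono[of n n' a a b b y] assms by simp
  then show ?thesis unfolding disc_diff by (simp add: algebra_simps)
qed

lemma integral_disc_shift: "integral {0..1} (\<lambda>a. disc y n (a + c)) = integral {0..1} (disc y n)"
  by (rule integral_periodic_shift) (auto simp: disc_periodic)

lemma integral_disc_increment:
  "integral {0..1} (\<lambda>a. disc y n (a + c) - disc y n (a + d)) = 0"
  by (subst integral_diff) (auto simp: integral_disc_shift)

lemma wdisc_periodic: "wdisc y \<rho> n (a + 1) = wdisc y \<rho> n a"
  using disc_periodic[of y n "a + \<rho> / real n"] disc_periodic[of y n a]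
  by (simp add: wdisc_def algebra_simps)

lemma integral_wdisc: "integral {0..1} (wdisc y \<rho> n) = 0"
  using integral_disc_increment[of y n "\<rho> / real n" 0] by (simp add: wdisc_def[abs_def])

text \<open>A one-sided bound and mean 0 give an L1 bound: z \<le> s implies |z| \<le> 2 s - z, and
  the last term integrates to 0.\<close>

lemma integral_abs_wdisc_le:
  assumes "\<And>a. e * wdisc y \<rho> n a \<le> s" "\<bar>e\<bar> = 1" "0 \<le> s"
  shows "integral {0..1} (\<lambda>a. \<bar>wdisc y \<rho> n (a + c)\<bar>) \<le> 2 * s"
proof -
  have "integral {0..1} (\<lambda>a. \<bar>wdisc y \<rho> n (a + c)\<bar>) = integral {0..1} (\<lambda>a. \<bar>wdisc y \<rho> n a\<bar>)"
    by (rule integral_periodic_shift) (auto simp: wdisc_periodic)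
  also have "\<dots> \<le> integral {0..1} (\<lambda>a. 2 * s - e * wdisc y \<rho> n a)"
  proof (rule integral_le)
    fix a
    have "\<bar>wdisc y \<rho> n a\<bar> = \<bar>e * wdisc y \<rho> n a\<bar>" using assms(2) by (simp add: abs_mult)
    also have "\<dots> \<le> 2 * s - e * wdisc y \<rho> n a" using assms(1)[of a] assms(3) by (simp add: abs_if)
    finally show "\<bar>wdisc y \<rho> n a\<bar> \<le> 2 * s - e * wdisc y \<rho> n a" .
  qed auto
  also have "\<dots> = 2 * s"
    by (subst integral_diff) (auto simp: integral_wdisc)
  finally show ?thesis .
qed

text \<open>The trivial estimate: an increment over length d is at least - n d and has mean 0. It
  serves for the very short shifts \<open>d0\<close>.\<close>

lemma integral_abs_disc_increment_le:
  assumes "0 \<le> d"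
  shows "integral {0..1} (\<lambda>a. \<bar>disc y n (a + c + d) - disc y n (a + c)\<bar>) \<le> 2 * real n * d"
proof -
  have "integral {0..1} (\<lambda>a. \<bar>disc y n (a + c + d) - disc y n (a + c)\<bar>)
    \<le> integral {0..1} (\<lambda>a. (disc y n (a + (c + d)) - disc y n (a + c)) + 2 * real n * d)"
  proof (rule integral_le)
    fix a
    have "- real n * d \<le> disc y n (a + c + d) - disc y n (a + c)"
      unfolding disc_diff using cnt_nonneg[of "a + c" "a + c + d" y n] assms by simp
    then show "\<bar>disc y n (a + c + d) - disc y n (a + c)\<bar>
      \<le> (disc y n (a + (c + d)) - disc y n (a + c)) + 2 * real n * d"
      using assms by (simp add: abs_if add.assoc)
  qed (auto simp: add.assoc)
  also have "\<dots> = 2 * real n * d"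
    by (subst integral_add) (auto simp: integral_disc_increment)
  finally show ?thesis .
qed

section \<open>Transport of increments by whole windows\<close>

lemma disc_chain:
  "disc y n (z + real j * (\<rho> / real n)) - disc y n z = (\<Sum>i<j. wdisc y \<rho> n (z + real i * (\<rho> / real n)))"
  by (induction j) (auto simp: wdisc_def algebra_simps add_divide_distrib)

text \<open>Two consecutive times \<open>p \<tau>\<close> and \<open>(p + 1) \<tau>\<close>: an interval is moved \<open>j\<close> windows to the right
  at the later time and \<open>j\<close> (longer) windows back to the left at the earlier time. Over
  \<open>j = 0, \<dots>, p\<close> the images tile exactly one window.\<close>

lemma disc_increment_transport:
  fixes p \<tau> :: nat
  assumes "0 < p" "0 < \<tau>" "0 < \<rho>"
  defines "n1 \<equiv> p * \<tau>" and "n2 \<equiv> (p + 1) * \<tau>"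
  defines "l \<equiv> \<rho> / real n1 - \<rho> / real n2"
  shows "real (p + 1) * (disc y n2 (z + l) - disc y n2 z) \<ge>
    wdisc y \<rho> n1 (z + l - \<rho> / real n1) - real (p + 1) * (real \<tau> * l)
    - (\<Sum>j<p+1. \<Sum>i<j. wdisc y \<rho> n2 (z + l + real i * (\<rho> / real n2)) - wdisc y \<rho> n2 (z + real i * (\<rho> / real n2))
        + wdisc y \<rho> n1 (z - real j * l + real i * (\<rho> / real n1))
        - wdisc y \<rho> n1 (z - real j * l + l + real i * (\<rho> / real n1)))"
proof -
  let ?w1 = "\<rho> / real n1" and ?w2 = "\<rho> / real n2"
  have l0: "0 \<le> l" unfolding l_def n1_def n2_def using assms(1-3) by (auto intro!: divide_left_mono mult_pos_pos add_pos_nonneg)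
  have pl: "real (p + 1) * l = ?w1"
  proof -
    have "Q * (\<rho> / (P * T) - \<rho> / (Q * T)) = \<rho> / (P * T)" if "0 < P" "0 < T" "Q = P + 1" for P Q T :: real
    proof -
      have "Q * (\<rho> / (P * T) - \<rho> / (Q * T)) = \<rho> * (Q - P) / (P * T)"
        using that by (simp add: divide_simps) (simp add: algebra_simps)
      then show ?thesis using that by simp
    qed
    from this[of "real p" "real \<tau>" "real (p + 1)"] show ?thesis
      unfolding l_def n1_def n2_def of_nat_mult using assms(1,2) by simp
  qed
  \<comment> \<open>Both routes meet at z + j w2, because a window of time n1 is longer by l.
    Changing the time there costs \<tau> l, and the windows travelled are collected in the
    sum.\<close>
  have one: "disc y n2 (z + l) - disc y n2 z \<ge> disc y n1 (z - real j * l + l) - disc y n1 (z - real j * l)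
     - real \<tau> * l - (\<Sum>i<j. wdisc y \<rho> n2 (z + l + real i * ?w2) - wdisc y \<rho> n2 (z + real i * ?w2)
        + wdisc y \<rho> n1 (z - real j * l + real i * ?w1)
        - wdisc y \<rho> n1 (z - real j * l + l + real i * ?w1))" for j
  proof -
    have a: "disc y n2 (z + l + real j * ?w2) - disc y n2 (z + l) = (\<Sum>i<j. wdisc y \<rho> n2 (z + l + real i * ?w2))"
            "disc y n2 (z + real j * ?w2) - disc y n2 z = (\<Sum>i<j. wdisc y \<rho> n2 (z + real i * ?w2))"
            "disc y n1 (z - real j * l + l + real j * ?w1) - disc y n1 (z - real j * l + l) = (\<Sum>i<j. wdisc y \<rho> n1 (z - real j * l + l + real i * ?w1))"
            "disc y n1 (z - real j * l + real j * ?w1) - disc y n1 (z - real j * l) = (\<Sum>i<j. wdisc y \<rho> n1 (z - real j * l + real i * ?w1))"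
      by (rule disc_chain)+
    have b: "z - real j * l + real j * ?w1 = z + real j * ?w2"
      by (simp add: l_def algebra_simps)
    have c: "z - real j * l + l + real j * ?w1 = z + l + real j * ?w2"
      by (simp add: l_def algebra_simps)
    have "disc y n1 (z + l + real j * ?w2) - disc y n1 (z + real j * ?w2)
      \<le> disc y n2 (z + l + real j * ?w2) - disc y n2 (z + real j * ?w2) + (real n2 - real n1) * l"
      using disc_increment_mono[of n1 n2 "z + real j * ?w2" "z + l + real j * ?w2" y] l0
      by (simp add: n1_def n2_def)
    moreover have "real n2 - real n1 = real \<tau>" by (simp add: n1_def n2_def algebra_simps)
    ultimately show ?thesis using a unfolding b c sum.distrib sum_subtractf by simp
  qed
  have tel: "(\<Sum>j<k. disc y n1 (z - real j * l + l) - disc y n1 (z - real j * l)) =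
     disc y n1 (z + l) - disc y n1 (z + l - real k * l)" for k
    by (induction k) (auto simp: algebra_simps)
  define q where "q = (\<lambda>j. \<Sum>i<j. wdisc y \<rho> n2 (z + l + real i * ?w2) - wdisc y \<rho> n2 (z + real i * ?w2)
        + wdisc y \<rho> n1 (z - real j * l + real i * ?w1)
        - wdisc y \<rho> n1 (z - real j * l + l + real i * ?w1))"
  have "(\<Sum>j<p+1. disc y n2 (z + l) - disc y n2 z) \<ge>
     (\<Sum>j<p+1. (disc y n1 (z - real j * l + l) - disc y n1 (z - real j * l)) - real \<tau> * l - q j)"
    using one unfolding q_def by (intro sum_mono)
  also have "(\<Sum>j<p+1. disc y n2 (z + l) - disc y n2 z) = real (p + 1) * (disc y n2 (z + l) - disc y n2 z)"
    by (simp only: sum_constant card_lessThan)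
  also have "(\<Sum>j<p+1. (disc y n1 (z - real j * l + l) - disc y n1 (z - real j * l)) - real \<tau> * l - q j) =
     (\<Sum>j<p+1. disc y n1 (z - real j * l + l) - disc y n1 (z - real j * l)) - (\<Sum>j<p+1. real \<tau> * l) - (\<Sum>j<p+1. q j)"
    by (rule trans[OF sum_subtractf]) (rule arg_cong2[where f = "(-)"], rule sum_subtractf, rule refl)
  also have "(\<Sum>j<p+1. disc y n1 (z - real j * l + l) - disc y n1 (z - real j * l)) = wdisc y \<rho> n1 (z + l - ?w1)"
    unfolding tel pl by (simp add: wdisc_def)
  also have "(\<Sum>j<p+1. real \<tau> * l) = real (p + 1) * (real \<tau> * l)"
    by (simp only: sum_constant card_lessThan)
  finally show ?thesis unfolding q_def .
qed

lemma integral_sum_le: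
  assumes "finite I" "\<And>i. i \<in> I \<Longrightarrow> bdd_borel (f i)" "\<And>i. i \<in> I \<Longrightarrow> integral {a..b} (f i) \<le> B i"
  shows "integral {a..b} (\<lambda>x. \<Sum>i\<in>I. f i x) \<le> (\<Sum>i\<in>I. B i)"
  using assms by (subst integral_sum) (auto intro!: sum_mono)

lemma integral_add_le:
  assumes "bdd_borel f" "bdd_borel g" "integral {a..b} f \<le> A" "integral {a..b} g \<le> B"
  shows "integral {a..b} (\<lambda>x. f x + g x) \<le> A + B"
  using assms by (subst integral_add) auto

text \<open>Since |D| \<le> D + 2 R and D has mean 0, a one-sided pointwise estimate of an increment
  is enough for its L1 norm.\<close>

lemma integral_abs_le_of_lower:
  assumes D: "bdd_borel D" and R: "bdd_borel R" and zero: "integral {0..1} D = 0"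
    and low: "\<And>a. - R a \<le> D a" and R0: "\<And>a. 0 \<le> R a"
  shows "integral {0..1} (\<lambda>a. \<bar>D a\<bar>) \<le> 2 * integral {0..1} R"
proof -
  have "integral {0..1} (\<lambda>a. \<bar>D a\<bar>) \<le> integral {0..1} (\<lambda>a. D a + 2 * R a)"
  proof (rule integral_le)
    fix a show "\<bar>D a\<bar> \<le> D a + 2 * R a"
      using low[of a] R0[of a] by (simp add: abs_if)
  qed (use D R in auto)
  also have "\<dots> = 2 * integral {0..1} R"
    using D R zero by (subst integral_add) auto
  finally show ?thesis .
qed

text \<open>The transport inequality in the mean. The triangular sum has p (p + 1) / 2 terms, each
  made of four window discrepancies of norm at most 2 s, so after division by p + 1 it costs the
  order of p s. The term 2 \<tau> l is smaller than the trivial bound 2 n2 l by the factor p +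
  1.\<close>

lemma integral_abs_disc_increment_later:
  fixes p \<tau> :: nat
  assumes pos: "0 < p" "0 < \<tau>" "0 < \<rho>"
  defines "n1 \<equiv> p * \<tau>" and "n2 \<equiv> (p + 1) * \<tau>"
  defines "l \<equiv> \<rho> / real n1 - \<rho> / real n2"
  assumes L1: "\<And>c. integral {0..1} (\<lambda>a. \<bar>wdisc y \<rho> n1 (a + c)\<bar>) \<le> 2 * s"
    and L2: "\<And>c. integral {0..1} (\<lambda>a. \<bar>wdisc y \<rho> n2 (a + c)\<bar>) \<le> 2 * s"
    and s: "0 \<le> s"
  shows "integral {0..1} (\<lambda>a. \<bar>disc y n2 (a + c + l) - disc y n2 (a + c)\<bar>)
    \<le> 2 * real \<tau> * l + 8 * real (p + 1) * s"
proof -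
  let ?w1 = "\<rho> / real n1" and ?w2 = "\<rho> / real n2"
  have l0: "0 \<le> l" unfolding l_def n1_def n2_def using pos
    by (auto intro!: divide_left_mono mult_pos_pos add_pos_nonneg)
  define S where "S = (\<lambda>j i a. \<bar>wdisc y \<rho> n2 (a + (c + l + real i * ?w2))\<bar> + \<bar>wdisc y \<rho> n2 (a + (c + real i * ?w2))\<bar>
        + \<bar>wdisc y \<rho> n1 (a + (c - real j * l + real i * ?w1))\<bar>
        + \<bar>wdisc y \<rho> n1 (a + (c - real j * l + l + real i * ?w1))\<bar>)"
  define Q where "Q = (\<lambda>a. \<bar>wdisc y \<rho> n1 (a + (c + l - ?w1))\<bar> + (\<Sum>j<p+1. \<Sum>i<j. S j i a))"
  define R where "R = (\<lambda>a. real \<tau> * l + Q a / real (p + 1))"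
  have bS: "bdd_borel (S j i)" for j i
    unfolding S_def by (intro bdd_borel_add bdd_borel_abs bdd_borel_shift bdd_borel_wdisc)
  have bQ: "bdd_borel Q"
    unfolding Q_def by (intro bdd_borel_add bdd_borel_abs bdd_borel_shift bdd_borel_wdisc bdd_borel_sum bS)
  have bR: "bdd_borel R" unfolding R_def using bQ by auto
  have iS: "integral {0..1} (S j i) \<le> 2 * s + 2 * s + 2 * s + 2 * s" for j i
    unfolding S_def
    by (intro integral_add_le L1 L2 bdd_borel_add bdd_borel_abs bdd_borel_shift bdd_borel_wdisc)
  have "integral {0..1} Q \<le> 2 * s + (\<Sum>j<p+1. \<Sum>i<j. 2 * s + 2 * s + 2 * s + 2 * s)"
    unfolding Q_def
    by (intro integral_add_le integral_sum_le iS L1 bS bdd_borel_abs bdd_borel_shift bdd_borel_wdisc bdd_borel_sum) auto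
  also have "(\<Sum>j<p+1. \<Sum>i<j. 2 * s + 2 * s + 2 * s + 2 * s) = (\<Sum>j<p+1. real j) * (8 * s)"
    unfolding sum_distrib_right by (rule sum.cong) auto
  also have "(\<Sum>j<p+1. real j) = real (p + 1) * real p / 2"
    by (induction p) (auto simp: field_simps)
  also have "2 * s + real (p + 1) * real p / 2 * (8 * s) \<le> 4 * real (p + 1) * real (p + 1) * s"
  proof -
    have "2 * s \<le> 4 * real (p + 1) * s" using s by (intro mult_right_mono) auto
    then show ?thesis by (simp add: algebra_simps)
  qed
  finally have iQ: "integral {0..1} Q \<le> 4 * real (p + 1) * real (p + 1) * s" .
  have iR: "integral {0..1} R \<le> real \<tau> * l + 4 * real (p + 1) * s"
  proof -
    have "integral {0..1} R = real \<tau> * l + integral {0..1} Q / real (p + 1)"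
      unfolding R_def using bQ by (subst integral_add) auto
    also have "integral {0..1} Q / real (p + 1) \<le> 4 * real (p + 1) * s"
      using iQ by (subst pos_divide_le_eq) (auto simp: mult_ac)
    finally show ?thesis by simp
  qed
  have Q0: "0 \<le> Q a" for a
    unfolding Q_def S_def by (intro add_nonneg_nonneg sum_nonneg) auto
  have "integral {0..1} (\<lambda>a. \<bar>disc y n2 (a + c + l) - disc y n2 (a + c)\<bar>) \<le> 2 * integral {0..1} R"
  proof (rule integral_abs_le_of_lower)
    show "bdd_borel (\<lambda>a. disc y n2 (a + c + l) - disc y n2 (a + c))"
      using bdd_borel_disc_shift[of y n2 "c + l"] by (auto simp: add.assoc)
    show "integral {0..1} (\<lambda>a. disc y n2 (a + c + l) - disc y n2 (a + c)) = 0"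
      using integral_disc_increment[of y n2 "c + l" c] by (simp add: add.assoc)
    show "bdd_borel R" by (rule bR)
    fix a
    show "0 \<le> R a" using Q0[of a] l0 by (simp add: R_def)
    let ?T = "(\<Sum>j<p+1. \<Sum>i<j. wdisc y \<rho> n2 (a + c + l + real i * ?w2) - wdisc y \<rho> n2 (a + c + real i * ?w2)
        + wdisc y \<rho> n1 (a + c - real j * l + real i * ?w1)
        - wdisc y \<rho> n1 (a + c - real j * l + l + real i * ?w1))"
    have "real (p + 1) * (disc y n2 (a + c + l) - disc y n2 (a + c)) \<ge>
       wdisc y \<rho> n1 (a + c + l - ?w1) - real (p + 1) * (real \<tau> * l) - ?T"
      using disc_increment_transport[OF pos, of y "a + c"] unfolding n1_def n2_def l_def .
    moreover have "?T \<le> (\<Sum>j<p+1. \<Sum>i<j. S j i a)"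
    proof (intro sum_mono)
      fix j i
      show "wdisc y \<rho> n2 (a + c + l + real i * ?w2) - wdisc y \<rho> n2 (a + c + real i * ?w2)
        + wdisc y \<rho> n1 (a + c - real j * l + real i * ?w1)
        - wdisc y \<rho> n1 (a + c - real j * l + l + real i * ?w1) \<le> S j i a"
        unfolding S_def by (simp add: algebra_simps)
    qed
    moreover have "- wdisc y \<rho> n1 (a + c + l - ?w1) \<le> \<bar>wdisc y \<rho> n1 (a + (c + l - ?w1))\<bar>"
      by (simp add: algebra_simps)
    ultimately have "- (real (p + 1) * (real \<tau> * l) + Q a) \<le> real (p + 1) * (disc y n2 (a + c + l) - disc y n2 (a + c))"
      unfolding Q_def by linarith
    moreover have "real (p + 1) * (real \<tau> * l) + Q a = real (p + 1) * R a"
      by (simp add: R_def field_simps)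
    ultimately have "real (p + 1) * (- R a) \<le> real (p + 1) * (disc y n2 (a + c + l) - disc y n2 (a + c))"
      by simp
    then show "- R a \<le> disc y n2 (a + c + l) - disc y n2 (a + c)"
      by (rule mult_left_le_imp_le) auto
  qed
  with iR show ?thesis by (simp add: algebra_simps)
qed

text \<open>Transport controls the later time only. At the earlier time monotonicity bounds the
  increment from above, and mean 0 again turns this into an L1 bound.\<close>

lemma integral_abs_disc_increment_earlier:
  fixes n1 n2 \<tau> :: nat
  assumes n: "n2 = n1 + \<tau>" and l0: "0 \<le> l"
    and B: "integral {0..1} (\<lambda>a. \<bar>disc y n2 (a + c + l) - disc y n2 (a + c)\<bar>) \<le> B"
  shows "integral {0..1} (\<lambda>a. \<bar>disc y n1 (a + c + l) - disc y n1 (a + c)\<bar>) \<le> 2 * B + 2 * real \<tau> * l"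
proof -
  let ?D2 = "\<lambda>a. disc y n2 (a + c + l) - disc y n2 (a + c)"
  have b: "bdd_borel (\<lambda>a. disc y n (a + c + l) - disc y n (a + c))" for n
    using bdd_borel_disc_shift[of y n "c + l"] by (auto simp: add.assoc)
  have "integral {0..1} (\<lambda>a. \<bar>- (disc y n1 (a + c + l) - disc y n1 (a + c))\<bar>)
    \<le> 2 * integral {0..1} (\<lambda>a. \<bar>?D2 a\<bar> + real \<tau> * l)"
  proof (rule integral_abs_le_of_lower)
    show "bdd_borel (\<lambda>a. - (disc y n1 (a + c + l) - disc y n1 (a + c)))"
      by (rule bdd_borel_minus[OF b])
    show "integral {0..1} (\<lambda>a. - (disc y n1 (a + c + l) - disc y n1 (a + c))) = 0"
      using integral_disc_increment[of y n1 c "c + l"] by (simp add: add.assoc)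
    show "bdd_borel (\<lambda>a. \<bar>?D2 a\<bar> + real \<tau> * l)" using b[of n2] by auto
    fix a
    show "- (\<bar>?D2 a\<bar> + real \<tau> * l) \<le> - (disc y n1 (a + c + l) - disc y n1 (a + c))"
      using disc_increment_mono[of n1 n2 "a + c" "a + c + l" y] l0 by (simp add: n abs_if)
    show "0 \<le> \<bar>?D2 a\<bar> + real \<tau> * l" using l0 by simp
  qed
  also have "integral {0..1} (\<lambda>a. \<bar>?D2 a\<bar> + real \<tau> * l) = integral {0..1} (\<lambda>a. \<bar>?D2 a\<bar>) + real \<tau> * l"
    using b[of n2] by (subst integral_add) auto
  finally show ?thesis using B by (simp add: abs_minus_commute)
qed

section \<open>Times at which a sliding interval contains an integer\<close>

lemma floor_diff_sum:
  fixes u v U V :: real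
  assumes "U \<le> u" "v \<le> V" "u \<le> v"
  shows "\<lfloor>v\<rfloor> - \<lfloor>u\<rfloor> = (\<Sum>k\<in>{\<lfloor>U\<rfloor><..\<lfloor>V\<rfloor>}. if u < of_int k \<and> of_int k \<le> v then 1 else 0)"
proof -
  have "(\<Sum>k\<in>{\<lfloor>U\<rfloor><..\<lfloor>V\<rfloor>}. if u < of_int k \<and> of_int k \<le> v then 1 else 0) =
    int (card ({\<lfloor>U\<rfloor><..\<lfloor>V\<rfloor>} \<inter> {k. u < of_int k \<and> of_int k \<le> v}))"
    by (simp add: sum.If_cases)
  also have "{\<lfloor>U\<rfloor><..\<lfloor>V\<rfloor>} \<inter> {k. u < of_int k \<and> of_int k \<le> v} = {\<lfloor>u\<rfloor><..\<lfloor>v\<rfloor>}"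
    using assms by (auto simp: floor_less_iff le_floor_iff)
  also have "int (card {\<lfloor>u\<rfloor><..\<lfloor>v\<rfloor>}) = \<lfloor>v\<rfloor> - \<lfloor>u\<rfloor>"
    using floor_mono[OF \<open>u \<le> v\<close>] by simp
  finally show ?thesis by simp
qed

text \<open>As n grows, the interval slides to the left with speed about \<rho> / n^2, so a fixed
  integer stays inside for at most d n2^2 / \<rho> + 1 times. The other factor is the number of
  integers that can be met at all, taken with \<open>d0\<close> so that it does not depend on
  d.\<close>

lemma sum_floor_sliding_upper:
  fixes n1 n2 :: nat and b \<rho> d d0 :: real
  assumes n: "0 < n1" "n1 \<le> n2" and \<rho>: "0 < \<rho>" and d: "0 \<le> d" "d \<le> d0"
  shows "real_of_int (\<Sum>n\<in>{n1<..n2}. \<lfloor>b + \<rho> / real n + d\<rfloor> - \<lfloor>b + \<rho> / real n\<rfloor>)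
    \<le> (d * (real n2)\<^sup>2 / \<rho> + 1) * real_of_int (\<lfloor>b + \<rho> / real n1 + d0\<rfloor> - \<lfloor>b + \<rho> / real n2\<rfloor>)"
proof -
  let ?K = "{\<lfloor>b + \<rho> / real n2\<rfloor><..\<lfloor>b + \<rho> / real n1 + d0\<rfloor>}"
  let ?P = "\<lambda>n k. b + \<rho> / real n < real_of_int k \<and> real_of_int k \<le> b + \<rho> / real n + d"
  have "(\<Sum>n\<in>{n1<..n2}. \<lfloor>b + \<rho> / real n + d\<rfloor> - \<lfloor>b + \<rho> / real n\<rfloor>) =
    (\<Sum>n\<in>{n1<..n2}. \<Sum>k\<in>?K. if ?P n k then 1 else 0)"
  proof (rule sum.cong)
    fix n assume "n \<in> {n1<..n2}"
    then have "\<rho> / real n2 \<le> \<rho> / real n" "\<rho> / real n \<le> \<rho> / real n1"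
      using n \<rho> by (auto intro!: divide_left_mono)
    then show "\<lfloor>b + \<rho> / real n + d\<rfloor> - \<lfloor>b + \<rho> / real n\<rfloor> = (\<Sum>k\<in>?K. if ?P n k then 1 else 0)"
      using d by (intro floor_diff_sum) auto
  qed simp
  also have "\<dots> = (\<Sum>k\<in>?K. \<Sum>n\<in>{n1<..n2}. if ?P n k then 1 else 0)" by (rule sum.swap)
  also have "\<dots> = (\<Sum>k\<in>?K. int (card {n\<in>{n1<..n2}. ?P n k}))"
    by (simp add: sum.If_cases Int_def)
  finally have eq: "real_of_int (\<Sum>n\<in>{n1<..n2}. \<lfloor>b + \<rho> / real n + d\<rfloor> - \<lfloor>b + \<rho> / real n\<rfloor>) =
    (\<Sum>k\<in>?K. real (card {n\<in>{n1<..n2}. ?P n k}))" by simp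
  have "(\<Sum>k\<in>?K. real (card {n\<in>{n1<..n2}. ?P n k})) \<le> (\<Sum>k\<in>?K. d * (real n2)\<^sup>2 / \<rho> + 1)"
  proof (rule sum_mono)
    fix k
    let ?S = "{n\<in>{n1<..n2}. ?P n k}"
    show "real (card ?S) \<le> d * (real n2)\<^sup>2 / \<rho> + 1"
    proof (cases "?S = {}")
      case True
      have "card ?S = 0" by (simp only: True card.empty)
      moreover have "0 \<le> d * (real n2)\<^sup>2 / \<rho>" using d \<rho> by simp
      ultimately show ?thesis by linarith
    next
      case False
      have fin: "finite ?S" by simp
      define p q where "p = Min ?S" and "q = Max ?S"
      have p: "p \<in> ?S" and q: "q \<in> ?S"
        unfolding p_def q_def using Min_in[OF fin False] Max_in[OF fin False] .
      have sub: "?S \<subseteq> {p..q}" unfolding p_def q_def using fin by (auto intro: Min_le Max_ge)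
      have "p \<le> q" using sub p by auto
      have "card ?S \<le> Suc q - p" using card_mono[OF _ sub] by simp
      then have c: "real (card ?S) \<le> real q - real p + 1" using \<open>p \<le> q\<close> by linarith
      \<comment> \<open>At the first time p the left end is already below k, at the last time q the
        right end is not yet below it.\<close>
      have "\<rho> / real p < \<rho> / real q + d" using p q by auto
      then have "\<rho> * (real q - real p) < d * (real p * real q)"
        using p q n by (simp add: field_simps)
      also have "\<dots> \<le> d * (real n2 * real n2)"
        using p q d by (intro mult_left_mono mult_mono) auto
      finally have "real q - real p \<le> d * (real n2)\<^sup>2 / \<rho>"
        using \<rho> by (simp add: field_simps power2_eq_square)
      then show ?thesis using c by linarith
    qed
  qed
  also have "\<dots> = (d * (real n2)\<^sup>2 / \<rho> + 1) * real_of_int (\<lfloor>b + \<rho> / real n1 + d0\<rfloor> - \<lfloor>b + \<rho> / real n2\<rfloor>)"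
  proof -
    have "\<rho> / real n2 \<le> \<rho> / real n1" using n \<rho> by (auto intro!: divide_left_mono)
    then have "\<lfloor>b + \<rho> / real n2\<rfloor> \<le> \<lfloor>b + \<rho> / real n1 + d0\<rfloor>" using d by (intro floor_mono) auto
    then show ?thesis by (simp add: mult.commute)
  qed
  finally show ?thesis using eq by simp
qed

text \<open>Only integers that the interval passes completely between the times n1 and n2 are
  counted, hence the shorter range \<open>?K\<close>; each of them is inside for at least d n1^2 /
  \<rho> - 1 times.\<close>

lemma sum_floor_sliding_lower:
  fixes n1 n2 :: nat and b \<rho> d d0 :: real
  assumes n: "0 < n1" "n1 \<le> n2" and \<rho>: "0 < \<rho>" and d: "0 \<le> d" "d \<le> d0"
    and d0: "\<rho> / real n2 + d0 \<le> \<rho> / real n1"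
  shows "real_of_int (\<Sum>n\<in>{n1<..n2}. \<lfloor>b + \<rho> / real n + d\<rfloor> - \<lfloor>b + \<rho> / real n\<rfloor>)
    \<ge> (d * (real n1)\<^sup>2 / \<rho> - 1) * real_of_int (\<lfloor>b + \<rho> / real n1\<rfloor> - \<lfloor>b + \<rho> / real n2 + d0\<rfloor>)"
proof -
  let ?L = "{\<lfloor>b + \<rho> / real n2\<rfloor><..\<lfloor>b + \<rho> / real n1 + d0\<rfloor>}"
  let ?K = "{\<lfloor>b + \<rho> / real n2 + d0\<rfloor><..\<lfloor>b + \<rho> / real n1\<rfloor>}"
  let ?P = "\<lambda>n k. b + \<rho> / real n < real_of_int k \<and> real_of_int k \<le> b + \<rho> / real n + d"
  have "(\<Sum>n\<in>{n1<..n2}. \<lfloor>b + \<rho> / real n + d\<rfloor> - \<lfloor>b + \<rho> / real n\<rfloor>) =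
    (\<Sum>n\<in>{n1<..n2}. \<Sum>k\<in>?L. if ?P n k then 1 else 0)"
  proof (rule sum.cong)
    fix n assume "n \<in> {n1<..n2}"
    then have "\<rho> / real n2 \<le> \<rho> / real n" "\<rho> / real n \<le> \<rho> / real n1"
      using n \<rho> by (auto intro!: divide_left_mono)
    then show "\<lfloor>b + \<rho> / real n + d\<rfloor> - \<lfloor>b + \<rho> / real n\<rfloor> = (\<Sum>k\<in>?L. if ?P n k then 1 else 0)"
      using d by (intro floor_diff_sum) auto
  qed simp
  also have "\<dots> = (\<Sum>k\<in>?L. \<Sum>n\<in>{n1<..n2}. if ?P n k then 1 else 0)" by (rule sum.swap)
  also have "\<dots> = (\<Sum>k\<in>?L. int (card {n\<in>{n1<..n2}. ?P n k}))"
    by (simp add: sum.If_cases Int_def)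
  finally have eq: "real_of_int (\<Sum>n\<in>{n1<..n2}. \<lfloor>b + \<rho> / real n + d\<rfloor> - \<lfloor>b + \<rho> / real n\<rfloor>) =
    (\<Sum>k\<in>?L. real (card {n\<in>{n1<..n2}. ?P n k}))" by simp
  have "(\<Sum>k\<in>?L. real (card {n\<in>{n1<..n2}. ?P n k})) \<ge> (\<Sum>k\<in>?K. real (card {n\<in>{n1<..n2}. ?P n k}))"
  proof (rule sum_mono2)
    have "\<lfloor>b + \<rho> / real n2\<rfloor> \<le> \<lfloor>b + \<rho> / real n2 + d0\<rfloor>" "\<lfloor>b + \<rho> / real n1\<rfloor> \<le> \<lfloor>b + \<rho> / real n1 + d0\<rfloor>"
      using d by (auto intro!: floor_mono)
    then show "?K \<subseteq> ?L" by auto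
  qed auto
  moreover have "(\<Sum>k\<in>?K. real (card {n\<in>{n1<..n2}. ?P n k})) \<ge> (\<Sum>k\<in>?K. d * (real n1)\<^sup>2 / \<rho> - 1)"
  proof (rule sum_mono)
    fix k assume k: "k \<in> ?K"
    let ?S = "{n\<in>{n1<..n2}. ?P n k}"
    define w where "w = real_of_int k - b"
    have w1: "w \<le> \<rho> / real n1" using k by (auto simp: w_def le_floor_iff)
    have w2: "\<rho> / real n2 + d < w" using k d by (auto simp: w_def floor_less_iff)
    have wd: "0 < w - d" "0 < w" using w2 d \<rho> n by (smt (verit) divide_nonneg_nonneg of_nat_0_le_iff)+
    \<comment> \<open>The real times at which the left and the right end of the interval pass
      k.\<close>
    define A B where "A = \<rho> / w" and "B = \<rho> / (w - d)"
    have A: "real n1 \<le> A" using w1 wd n \<rho> by (simp add: A_def field_simps)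
    have B: "B \<le> real n2"
    proof -
      have "\<rho> / real n2 < w - d" using w2 by simp
      then show ?thesis using wd n \<rho> by (simp add: B_def field_simps)
    qed
    have AB: "d * (real n1)\<^sup>2 / \<rho> \<le> B - A"
    proof -
      have "(w - d) * w \<le> (\<rho> / real n1) * (\<rho> / real n1)"
        using w1 wd d by (intro mult_mono) auto
      then have "d * \<rho> / ((\<rho> / real n1) * (\<rho> / real n1)) \<le> d * \<rho> / ((w - d) * w)"
        using wd d \<rho> n by (intro divide_left_mono mult_pos_pos divide_pos_pos mult_nonneg_nonneg) auto
      moreover have "d * \<rho> / ((\<rho> / real n1) * (\<rho> / real n1)) = d * (real n1)\<^sup>2 / \<rho>"
        using \<rho> n by (simp add: field_simps power2_eq_square)
      moreover have "d * \<rho> / ((w - d) * w) = B - A"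
        using wd by (simp add: A_def B_def field_simps)
      ultimately show ?thesis by simp
    qed
    have A0: "0 \<le> A" using A n by linarith
    have B0: "0 \<le> B" using wd \<rho> by (simp add: B_def)
    have "{nat \<lfloor>A\<rfloor><..nat \<lfloor>B\<rfloor>} \<subseteq> ?S"
    proof
      fix n assume "n \<in> {nat \<lfloor>A\<rfloor><..nat \<lfloor>B\<rfloor>}"
      then have n': "A < real n" "real n \<le> B"
        using A0 B0 by (auto simp: nat_less_iff floor_less_iff le_nat_iff le_floor_iff)
      have npos: "0 < real n" using n' A0 by simp
      have "n1 < n" "n \<le> n2" using n' A B by linarith+
      moreover have "\<rho> / real n < w" using n'(1) wd npos by (simp add: A_def field_simps)
      moreover have "w - d \<le> \<rho> / real n" using n'(2) wd npos by (simp add: B_def field_simps)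
      ultimately show "n \<in> ?S" by (auto simp: w_def)
    qed
    then have "nat \<lfloor>B\<rfloor> - nat \<lfloor>A\<rfloor> \<le> card ?S" using card_mono[of ?S "{nat \<lfloor>A\<rfloor><..nat \<lfloor>B\<rfloor>}"] by simp
    then have "\<lfloor>B\<rfloor> - \<lfloor>A\<rfloor> \<le> int (card ?S)" using A0 B0 by linarith
    then have "B - A - 1 \<le> real (card ?S)" by linarith
    then show "d * (real n1)\<^sup>2 / \<rho> - 1 \<le> real (card ?S)" using AB by linarith
  qed
  moreover have "(\<Sum>k\<in>?K. d * (real n1)\<^sup>2 / \<rho> - 1) =
    (d * (real n1)\<^sup>2 / \<rho> - 1) * real_of_int (\<lfloor>b + \<rho> / real n1\<rfloor> - \<lfloor>b + \<rho> / real n2 + d0\<rfloor>)"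
  proof -
    have "\<lfloor>b + \<rho> / real n2 + d0\<rfloor> \<le> \<lfloor>b + \<rho> / real n1\<rfloor>" using d0 by (intro floor_mono) auto
    then show ?thesis by (simp add: mult.commute)
  qed
  ultimately show ?thesis using eq by linarith
qed

section \<open>Averages over sliding windows\<close>

text \<open>Counts are enlarged to the points present at time n2, and expected counts are lowered to
  n1 d. The sliding estimate then applies to each point, and the integers met correspond to the
  points of one interval of length l + d0 at time n2. The error is therefore again an increment of
  \<open>disc\<close>.\<close>

lemma sliding_disc_upper:
  fixes n1 n2 :: nat and \<rho> d d0 a :: real
  assumes n: "0 < n1" "n1 \<le> n2" and \<rho>: "0 < \<rho>" and d: "0 \<le> d" "d \<le> d0"
  defines "l \<equiv> \<rho> / real n1 - \<rho> / real n2"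
  shows "(\<Sum>n\<in>{n1<..n2}. disc y n (a + d + \<rho> / real n) - disc y n (a + \<rho> / real n))
    \<le> (d * (real n2)\<^sup>2 / \<rho> + 1) *
       (real n2 * (l + d0) + (disc y n2 (a + \<rho> / real n1 + d0) - disc y n2 (a + \<rho> / real n2)))
      - real (n2 - n1) * (real n1 * d)"
proof -
  have "(\<Sum>n\<in>{n1<..n2}. disc y n (a + d + \<rho> / real n) - disc y n (a + \<rho> / real n))
    \<le> (\<Sum>n\<in>{n1<..n2}. real_of_int (cnt y n2 (a + \<rho> / real n) (a + \<rho> / real n + d)) - real n1 * d)"
  proof (rule sum_mono)
    fix n assume nn: "n \<in> {n1<..n2}"
    have "real_of_int (cnt y n (a + \<rho> / real n) (a + \<rho> / real n + d))
      \<le> real_of_int (cnt y n2 (a + \<rho> / real n) (a + \<rho> / real n + d))"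
      unfolding of_int_le_iff by (rule cnt_mono) (use nn d in auto)
    moreover have "real n1 * d \<le> real n * d" using nn d by (intro mult_right_mono) auto
    ultimately show "disc y n (a + d + \<rho> / real n) - disc y n (a + \<rho> / real n)
       \<le> real_of_int (cnt y n2 (a + \<rho> / real n) (a + \<rho> / real n + d)) - real n1 * d"
      unfolding disc_diff by (simp add: add_ac)
  qed
  also have "\<dots> = real_of_int (\<Sum>i=1..n2. \<Sum>n\<in>{n1<..n2}. \<lfloor>a - y i + \<rho> / real n + d\<rfloor> - \<lfloor>a - y i + \<rho> / real n\<rfloor>)
      - real (n2 - n1) * (real n1 * d)"
  proof -
    have "(\<Sum>n\<in>{n1<..n2}. real_of_int (cnt y n2 (a + \<rho> / real n) (a + \<rho> / real n + d)))
      = real_of_int (\<Sum>i=1..n2. \<Sum>n\<in>{n1<..n2}. \<lfloor>a - y i + \<rho> / real n + d\<rfloor> - \<lfloor>a - y i + \<rho> / real n\<rfloor>)"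
      unfolding cnt_def of_int_sum
      by (subst sum.swap, intro sum.cong refl) (simp add: algebra_simps)
    then show ?thesis by (simp only: sum_subtractf sum_constant card_greaterThanAtMost)
  qed
  also have "real_of_int (\<Sum>i=1..n2. \<Sum>n\<in>{n1<..n2}. \<lfloor>a - y i + \<rho> / real n + d\<rfloor> - \<lfloor>a - y i + \<rho> / real n\<rfloor>)
    \<le> (\<Sum>i=1..n2. (d * (real n2)\<^sup>2 / \<rho> + 1) *
        real_of_int (\<lfloor>a - y i + \<rho> / real n1 + d0\<rfloor> - \<lfloor>a - y i + \<rho> / real n2\<rfloor>))"
    unfolding of_int_sum[of _ "{1..n2}"] by (intro sum_mono sum_floor_sliding_upper assms)
  also have "\<dots> = (d * (real n2)\<^sup>2 / \<rho> + 1) * real_of_int (cnt y n2 (a + \<rho> / real n2) (a + \<rho> / real n1 + d0))"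
    unfolding cnt_def of_int_sum sum_distrib_left by (simp add: algebra_simps)
  also have "real_of_int (cnt y n2 (a + \<rho> / real n2) (a + \<rho> / real n1 + d0)) =
      real n2 * (l + d0) + (disc y n2 (a + \<rho> / real n1 + d0) - disc y n2 (a + \<rho> / real n2))"
    unfolding disc_diff l_def by (simp add: algebra_simps)
  finally show ?thesis by simp
qed

text \<open>The mirror image: counts are reduced to the points present at time n1, and the interval
  shrinks to length l - d0.\<close>

lemma sliding_disc_lower:
  fixes n1 n2 :: nat and \<rho> d d0 a :: real
  assumes n: "0 < n1" "n1 \<le> n2" and \<rho>: "0 < \<rho>" and d: "0 \<le> d" "d \<le> d0"
  defines "l \<equiv> \<rho> / real n1 - \<rho> / real n2"
  assumes d0: "d0 \<le> l"
  shows "(\<Sum>n\<in>{n1<..n2}. disc y n (a + d + \<rho> / real n) - disc y n (a + \<rho> / real n))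
    \<ge> (d * (real n1)\<^sup>2 / \<rho> - 1) *
       (real n1 * (l - d0) + (disc y n1 (a + \<rho> / real n1) - disc y n1 (a + \<rho> / real n2 + d0)))
      - real (n2 - n1) * (real n2 * d)"
proof -
  have "(\<Sum>n\<in>{n1<..n2}. disc y n (a + d + \<rho> / real n) - disc y n (a + \<rho> / real n))
    \<ge> (\<Sum>n\<in>{n1<..n2}. real_of_int (cnt y n1 (a + \<rho> / real n) (a + \<rho> / real n + d)) - real n2 * d)"
  proof (rule sum_mono)
    fix n assume nn: "n \<in> {n1<..n2}"
    have "real_of_int (cnt y n1 (a + \<rho> / real n) (a + \<rho> / real n + d))
      \<le> real_of_int (cnt y n (a + \<rho> / real n) (a + \<rho> / real n + d))"
      unfolding of_int_le_iff by (rule cnt_mono) (use nn d in auto)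
    moreover have "real n * d \<le> real n2 * d" using nn d by (intro mult_right_mono) auto
    ultimately show "real_of_int (cnt y n1 (a + \<rho> / real n) (a + \<rho> / real n + d)) - real n2 * d
       \<le> disc y n (a + d + \<rho> / real n) - disc y n (a + \<rho> / real n)"
      unfolding disc_diff by (simp add: add_ac)
  qed
  moreover have "(\<Sum>n\<in>{n1<..n2}. real_of_int (cnt y n1 (a + \<rho> / real n) (a + \<rho> / real n + d)) - real n2 * d)
     = real_of_int (\<Sum>i=1..n1. \<Sum>n\<in>{n1<..n2}. \<lfloor>a - y i + \<rho> / real n + d\<rfloor> - \<lfloor>a - y i + \<rho> / real n\<rfloor>)
      - real (n2 - n1) * (real n2 * d)"
  proof -
    have "(\<Sum>n\<in>{n1<..n2}. real_of_int (cnt y n1 (a + \<rho> / real n) (a + \<rho> / real n + d)))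
      = real_of_int (\<Sum>i=1..n1. \<Sum>n\<in>{n1<..n2}. \<lfloor>a - y i + \<rho> / real n + d\<rfloor> - \<lfloor>a - y i + \<rho> / real n\<rfloor>)"
      unfolding cnt_def of_int_sum
      by (subst sum.swap, intro sum.cong refl) (simp add: algebra_simps)
    then show ?thesis by (simp only: sum_subtractf sum_constant card_greaterThanAtMost)
  qed
  moreover have "real_of_int (\<Sum>i=1..n1. \<Sum>n\<in>{n1<..n2}. \<lfloor>a - y i + \<rho> / real n + d\<rfloor> - \<lfloor>a - y i + \<rho> / real n\<rfloor>)
    \<ge> (\<Sum>i=1..n1. (d * (real n1)\<^sup>2 / \<rho> - 1) *
        real_of_int (\<lfloor>a - y i + \<rho> / real n1\<rfloor> - \<lfloor>a - y i + \<rho> / real n2 + d0\<rfloor>))"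
    unfolding of_int_sum[of _ "{1..n1}"] using d0 unfolding l_def
    by (intro sum_mono sum_floor_sliding_lower assms) auto
  moreover have "(\<Sum>i=1..n1. (d * (real n1)\<^sup>2 / \<rho> - 1) *
        real_of_int (\<lfloor>a - y i + \<rho> / real n1\<rfloor> - \<lfloor>a - y i + \<rho> / real n2 + d0\<rfloor>))
     = (d * (real n1)\<^sup>2 / \<rho> - 1) * real_of_int (cnt y n1 (a + \<rho> / real n2 + d0) (a + \<rho> / real n1))"
    unfolding cnt_def of_int_sum sum_distrib_left by (simp add: algebra_simps)
  moreover have "real_of_int (cnt y n1 (a + \<rho> / real n2 + d0) (a + \<rho> / real n1)) =
      real n1 * (l - d0) + (disc y n1 (a + \<rho> / real n1) - disc y n1 (a + \<rho> / real n2 + d0))"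
    unfolding disc_diff l_def by (simp add: algebra_simps)
  ultimately show ?thesis by simp
qed

definition sliding_disc :: "(nat \<Rightarrow> real) \<Rightarrow> real \<Rightarrow> nat \<Rightarrow> nat \<Rightarrow> real \<Rightarrow> real" where
  "sliding_disc y \<rho> n1 n2 a = (\<Sum>n\<in>{n1<..n2}. disc y n (a + \<rho> / real n))"

text \<open>P and T stand for p and \<tau>, so the block runs from time P T to (P + 1) T. The number
  of crossings and the expected count agree to first order; the four remaining groups of terms are
  estimated separately.\<close>

lemma sliding_upper_numeric:
  fixes P T \<rho> d x w K l d0 :: real
  assumes P: "1 \<le> P" "P + 1 \<le> 2 * K" and T: "0 < T" and \<rho>: "0 < \<rho>" and d: "0 \<le> d" "d \<le> d0"
    and d0: "d0 = x / T" and l: "l = \<rho> / (P * (P + 1) * T)" and w: "\<bar>w\<bar> \<le> W"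
  shows "(d * ((P + 1) * T)\<^sup>2 / \<rho> + 1) * ((P + 1) * T * (l + d0) + w) - T * (P * T * d)
    \<le> T * (3 * x + 8 * x\<^sup>2 * K^3 / \<rho> + 2 * K * (l + d0) + (4 * K\<^sup>2 * x / \<rho> + 1 / T) * W)"
proof -
  have x: "0 \<le> x" "d * T \<le> x" using d d0 T by (auto simp: field_simps)
  have W: "0 \<le> W" using w by simp
  have l0: "0 \<le> l" using l P T \<rho> by simp
  let ?Q = "P + 1"
  have Q2: "?Q\<^sup>2 \<le> 4 * K\<^sup>2" using power_mono[OF P(2), of 2] P(1) by (simp add: power_mult_distrib)
  have Q3: "?Q^3 \<le> 8 * K^3" using power_mono[OF P(2), of 3] P(1) by (simp add: power_mult_distrib)
  have "(d * (?Q * T)\<^sup>2 / \<rho> + 1) * w \<le> (d * (?Q * T)\<^sup>2 / \<rho> + 1) * W"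
    using w d \<rho> by (intro mult_left_mono) auto
  also have "\<dots> = T * ((d * T) * ?Q\<^sup>2 / \<rho> + 1 / T) * W"
    using T by (simp add: field_simps power2_eq_square)
  also have "\<dots> \<le> T * (x * (4 * K\<^sup>2) / \<rho> + 1 / T) * W"
    using T W \<rho> x Q2 d by (intro mult_left_mono mult_right_mono add_mono divide_right_mono mult_mono) auto
  finally have 1: "(d * (?Q * T)\<^sup>2 / \<rho> + 1) * w \<le> T * ((4 * K\<^sup>2 * x / \<rho> + 1 / T) * W)"
    by (simp add: mult_ac)
  have 2: "?Q * T * (l + d0) \<le> T * (2 * K * (l + d0))"
  proof -
    have "?Q * (l + d0) \<le> 2 * K * (l + d0)" using P l0 d by (intro mult_right_mono) auto
    then have "T * (?Q * (l + d0)) \<le> T * (2 * K * (l + d0))" using T by (intro mult_left_mono) auto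
    then show ?thesis by (simp add: mult_ac)
  qed
  have 3: "(d * (?Q * T)\<^sup>2 / \<rho>) * (?Q * T * d0) \<le> T * (8 * x\<^sup>2 * K^3 / \<rho>)"
  proof -
    have "(d * (?Q * T)\<^sup>2 / \<rho>) * (?Q * T * d0) = T * ((d * T) * x * ?Q^3 / \<rho>)"
      using T by (simp add: d0 power2_eq_square power3_eq_cube)
    also have "\<dots> \<le> T * (x * x * (8 * K^3) / \<rho>)"
      using T x Q3 \<rho> P d by (intro mult_left_mono divide_right_mono mult_mono) auto
    finally show ?thesis by (simp add: power2_eq_square mult_ac)
  qed
  \<comment> \<open>The main terms cancel up to 3 x, because (P + 1)^2 / P exceeds P by at most
    3.\<close>
  have 4: "(d * (?Q * T)\<^sup>2 / \<rho>) * (?Q * T * l) - T * (P * T * d) \<le> T * (3 * x)"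
  proof -
    have "(d * (?Q * T)\<^sup>2 / \<rho>) * (?Q * T * l) = T * ((d * T) * (?Q\<^sup>2 / P))"
      using T P \<rho> by (simp add: l power2_eq_square)
    moreover have "?Q\<^sup>2 / P \<le> P + 3" using P by (simp add: field_simps power2_eq_square)
    then have "T * ((d * T) * (?Q\<^sup>2 / P)) \<le> T * ((d * T) * (P + 3))"
      using T d by (intro mult_left_mono) auto
    moreover have "T * ((d * T) * 3) \<le> T * (x * 3)"
      using T x by (intro mult_left_mono mult_right_mono) auto
    ultimately show ?thesis by (simp add: algebra_simps)
  qed
  have "(d * (?Q * T)\<^sup>2 / \<rho> + 1) * (?Q * T * (l + d0) + w) - T * (P * T * d) =
    (d * (?Q * T)\<^sup>2 / \<rho> + 1) * w + ?Q * T * (l + d0) + (d * (?Q * T)\<^sup>2 / \<rho>) * (?Q * T * d0)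
    + ((d * (?Q * T)\<^sup>2 / \<rho>) * (?Q * T * l) - T * (P * T * d))"
  proof -
    have "(A + 1) * (q * (l + d0) + w) - t = (A + 1) * w + q * (l + d0) + A * (q * d0) + (A * (q * l) - t)" for A q t :: real
      by (simp add: algebra_simps)
    then show ?thesis .
  qed
  also have "\<dots> \<le> T * ((4 * K\<^sup>2 * x / \<rho> + 1 / T) * W) + T * (2 * K * (l + d0)) + T * (8 * x\<^sup>2 * K^3 / \<rho>) + T * (3 * x)"
    using 1 2 3 4 by (intro add_mono)
  also have "\<dots> = T * (3 * x + 8 * x\<^sup>2 * K^3 / \<rho> + 2 * K * (l + d0) + (4 * K\<^sup>2 * x / \<rho> + 1 / T) * W)"
    by (simp add: distrib_left)
  finally show ?thesis .
qed

lemma sliding_lower_numeric: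
  fixes P T \<rho> d x w K l d0 :: real
  assumes P: "1 \<le> P" "P + 1 \<le> 2 * K" and T: "0 < T" and \<rho>: "0 < \<rho>" and d: "0 \<le> d" "d \<le> d0"
    and d0: "d0 = x / T" and l: "l = \<rho> / (P * (P + 1) * T)" and w: "\<bar>w\<bar> \<le> W"
  shows "(d * (P * T)\<^sup>2 / \<rho> - 1) * (P * T * (l - d0) + w) - T * ((P + 1) * T * d)
    \<ge> - (T * (3 * x + 8 * x\<^sup>2 * K^3 / \<rho> + 2 * K * (l + d0) + (4 * K\<^sup>2 * x / \<rho> + 1 / T) * W))"
proof -
  have x: "0 \<le> x" "d * T \<le> x" using d d0 T by (auto simp: field_simps)
  have W: "0 \<le> W" using w by simp
  have l0: "0 \<le> l" using l P T \<rho> by simp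
  have PK: "P \<le> 2 * K" using P by simp
  have Q2: "P\<^sup>2 \<le> 4 * K\<^sup>2" using power_mono[OF PK, of 2] P(1) by (simp add: power_mult_distrib)
  have Q3: "P^3 \<le> 8 * K^3" using power_mono[OF PK, of 3] P(1) by (simp add: power_mult_distrib)
  have "- ((d * (P * T)\<^sup>2 / \<rho> - 1) * w) \<le> \<bar>d * (P * T)\<^sup>2 / \<rho> - 1\<bar> * \<bar>w\<bar>"
    using abs_ge_minus_self[of "(d * (P * T)\<^sup>2 / \<rho> - 1) * w"] by (simp only: abs_mult)
  also have "\<dots> \<le> (d * (P * T)\<^sup>2 / \<rho> + 1) * W"
  proof (rule mult_mono)
    have A: "0 \<le> A \<Longrightarrow> \<bar>A - 1\<bar> \<le> A + 1" for A :: real by (simp add: abs_if)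
    have "0 \<le> d * (P * T)\<^sup>2 / \<rho>" using d \<rho> by simp
    from A[OF this] this show "\<bar>d * (P * T)\<^sup>2 / \<rho> - 1\<bar> \<le> d * (P * T)\<^sup>2 / \<rho> + 1" "0 \<le> d * (P * T)\<^sup>2 / \<rho> + 1" by auto
  qed (use w in auto)
  also have "\<dots> = T * ((d * T) * P\<^sup>2 / \<rho> + 1 / T) * W"
    using T by (simp add: field_simps power2_eq_square)
  also have "\<dots> \<le> T * (x * (4 * K\<^sup>2) / \<rho> + 1 / T) * W"
    using T W \<rho> x Q2 d by (intro mult_left_mono mult_right_mono add_mono divide_right_mono mult_mono) auto
  finally have 1: "- ((d * (P * T)\<^sup>2 / \<rho> - 1) * w) \<le> T * ((4 * K\<^sup>2 * x / \<rho> + 1 / T) * W)"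
    by (simp add: mult_ac)
  have 2: "P * T * (l - d0) \<le> T * (2 * K * (l + d0))"
  proof -
    have "P * (l - d0) \<le> 2 * K * (l + d0)" using P l0 d PK
      by (intro order_trans[OF mult_left_mono[of "l - d0" "l + d0" P] mult_right_mono]) auto
    then have "T * (P * (l - d0)) \<le> T * (2 * K * (l + d0))" using T by (intro mult_left_mono) auto
    then show ?thesis by (simp add: mult_ac)
  qed
  have 3: "(d * (P * T)\<^sup>2 / \<rho>) * (P * T * d0) \<le> T * (8 * x\<^sup>2 * K^3 / \<rho>)"
  proof -
    have "(d * (P * T)\<^sup>2 / \<rho>) * (P * T * d0) = T * ((d * T) * x * P^3 / \<rho>)"
      using T by (simp add: d0 power2_eq_square power3_eq_cube)
    also have "\<dots> \<le> T * (x * x * (8 * K^3) / \<rho>)"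
      using T x Q3 \<rho> P d by (intro mult_left_mono divide_right_mono mult_mono) auto
    finally show ?thesis by (simp add: power2_eq_square mult_ac)
  qed
  \<comment> \<open>The same cancellation, now from P + 1 - P^2 / (P + 1) \<le> 3.\<close>
  have 4: "T * ((P + 1) * T * d) - (d * (P * T)\<^sup>2 / \<rho>) * (P * T * l) \<le> T * (3 * x)"
  proof -
    have "(d * (P * T)\<^sup>2 / \<rho>) * (P * T * l) = T * ((d * T) * (P\<^sup>2 / (P + 1)))"
      using T P \<rho> by (simp add: l power2_eq_square)
    moreover have "P - 2 \<le> P\<^sup>2 / (P + 1)" using P by (simp add: field_simps power2_eq_square)
    then have "T * ((d * T) * (P - 2)) \<le> T * ((d * T) * (P\<^sup>2 / (P + 1)))"
      using T d by (intro mult_left_mono) auto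
    moreover have "T * ((d * T) * 3) \<le> T * (x * 3)"
      using T x by (intro mult_left_mono mult_right_mono) auto
    ultimately show ?thesis by (simp add: algebra_simps)
  qed
  have "- ((d * (P * T)\<^sup>2 / \<rho> - 1) * (P * T * (l - d0) + w) - T * ((P + 1) * T * d)) =
    - ((d * (P * T)\<^sup>2 / \<rho> - 1) * w) + P * T * (l - d0) + (d * (P * T)\<^sup>2 / \<rho>) * (P * T * d0)
    + (T * ((P + 1) * T * d) - (d * (P * T)\<^sup>2 / \<rho>) * (P * T * l))"
  proof -
    have "- ((A - 1) * (q * (l - d0) + w) - t) = - ((A - 1) * w) + q * (l - d0) + A * (q * d0) + (t - A * (q * l))" for A q t :: real
      by (simp add: algebra_simps)
    then show ?thesis .
  qed
  also have "\<dots> \<le> T * ((4 * K\<^sup>2 * x / \<rho> + 1 / T) * W) + T * (2 * K * (l + d0)) + T * (8 * x\<^sup>2 * K^3 / \<rho>) + T * (3 * x)"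
    using 1 2 3 4 by (intro add_mono)
  also have "\<dots> = T * (3 * x + 8 * x\<^sup>2 * K^3 / \<rho> + 2 * K * (l + d0) + (4 * K\<^sup>2 * x / \<rho> + 1 / T) * W)"
    by (simp add: distrib_left)
  finally show ?thesis by linarith
qed

text \<open>The bulk 32 x comes from 8 T l, as 4 K^2 x / \<rho> times 8 \<rho> / K^2 is 32 x; the
  cancelled main terms leave 3 x. All else is below x: the bound \<open>big\<close> absorbs the
  powers of K, and 52 = 4 * 13 in \<open>T_big\<close> makes the terms of size 13 \<rho> / T at most
  x / 4.\<close>

lemma variation_integral_numeric:
  fixes K s \<rho> x T l d0 w :: real
  assumes K: "1 \<le> K" and s: "0 \<le> s" and x: "0 < x" "x \<le> 1" and T: "1 \<le> T"
    and big: "1000 * K^3 * (s + 1) \<le> \<rho>" and T_big: "52 * \<rho> \<le> T * x"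
    and l: "T * l \<le> \<rho> / K\<^sup>2" and d0: "d0 = x / T"
    and w: "w \<le> 8 * (T * l) + 48 * K * s + 8 * K * x"
  shows "3 * x + 8 * x\<^sup>2 * K^3 / \<rho> + 2 * K * (l + d0) + (4 * K\<^sup>2 * x / \<rho> + 1 / T) * w \<le> 36 * x"
proof -
  have K3: "1 \<le> K^3" "K \<le> K^3" "K\<^sup>2 \<le> K^3" "1 \<le> K\<^sup>2" using K by (auto simp: power_increasing[of 1 3 K, simplified] power_increasing)
  have Ks: "K * s \<le> K^3 * s" using K3 s by (intro mult_right_mono) auto
  have big': "1000 * (K^3 * s) + 1000 * K^3 \<le> \<rho>" using big by (simp add: algebra_simps)
  have K3s: "0 \<le> K^3 * s" using K s by simp
  have \<rho>: "0 < \<rho>" using big' K3 K3s by linarith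
  have w': "w \<le> 8 * (\<rho> / K\<^sup>2) + 48 * (K * s) + 8 * K" 
  proof -
    have "8 * K * x \<le> 8 * K * 1" using K x by (intro mult_left_mono) auto
    then show ?thesis using w l by linarith
  qed
  have dK: "\<rho> / K\<^sup>2 \<le> \<rho>" using divide_left_mono[of 1 "K\<^sup>2" \<rho>] \<rho> K3 K by simp
  have 1: "8 * x\<^sup>2 * K^3 / \<rho> \<le> x * (1 / 100)"
  proof -
    have "8 * x\<^sup>2 * K^3 / \<rho> = x * (8 * x * K^3 / \<rho>)" by (simp add: power2_eq_square)
    also have "8 * x * K^3 / \<rho> \<le> 1 / 100"
    proof -
      have "x * K^3 \<le> 1 * K^3" using x K3 K by (intro mult_right_mono) auto
      then show ?thesis using big' K3s \<rho> by (simp add: field_simps)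
    qed
    then have "x * (8 * x * K^3 / \<rho>) \<le> x * (1 / 100)" using x by (intro mult_left_mono) auto
    finally show ?thesis .
  qed
  have 2: "2 * K * (l + d0) \<le> (2 * \<rho> + \<rho>) / T"
  proof -
    have "K * (T * l) \<le> K * (\<rho> / K\<^sup>2)" using l K by (intro mult_left_mono) auto
    also have "\<dots> = \<rho> / K" using K by (simp add: power2_eq_square)
    also have "\<dots> \<le> \<rho>" using \<rho> K by (simp add: field_simps mult_le_cancel_left1)
    finally have "K * (T * l) \<le> \<rho>" .
    moreover have "K * x \<le> K * 1" using K x by (intro mult_left_mono) auto
    then have "2 * (K * x) \<le> \<rho>" using K3 big' K3s by linarith
    ultimately have "2 * K * (l + d0) * T \<le> 2 * \<rho> + \<rho>"
      using T by (simp add: d0 algebra_simps)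
    then show ?thesis using T by (simp add: pos_le_divide_eq)
  qed
  have 3: "1 / T * w \<le> (10 * \<rho>) / T"
  proof -
    have "w \<le> 10 * \<rho>" using w' dK Ks K3 big' K3s by linarith
    then show ?thesis using T by (simp add: divide_right_mono)
  qed
  have 4: "4 * K\<^sup>2 * x / \<rho> * w \<le> x * (32 + 1/4)"
  proof -
    have "4 * K\<^sup>2 * x / \<rho> * w \<le> 4 * K\<^sup>2 * x / \<rho> * (8 * (\<rho> / K\<^sup>2) + 48 * (K * s) + 8 * K)"
      using w' K x \<rho> by (intro mult_left_mono divide_nonneg_nonneg mult_nonneg_nonneg) auto
    also have "\<dots> = x * (32 + (192 * (K^3 * s) + 32 * K^3) / \<rho>)"
      using K \<rho> by (simp add: field_simps power2_eq_square power3_eq_cube)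
    also have "\<dots> \<le> x * (32 + 1/4)"
    proof -
      have "(192 * (K^3 * s) + 32 * K^3) / \<rho> \<le> 1/4" using big' K3s K3 \<rho> by (simp add: field_simps)
      then show ?thesis using x K by (intro mult_left_mono) auto
    qed
    finally show ?thesis .
  qed
  have 5: "(2 * \<rho> + \<rho>) / T + (10 * \<rho>) / T \<le> x * (1/4)"
    using T_big T by (simp add: field_simps)
  have "3 * x + A + B + (C + D) \<le> 36 * x"
    if "A \<le> x * (1 / 100)" "B \<le> M" "D \<le> N" "C \<le> x * (32 + 1/4)" "M + N \<le> x * (1/4)" for A B C D M N
    using that x by (simp add: distrib_left)
  from this[OF 1 2 3 4 5] show ?thesis by (simp only: distrib_right)
qed

text \<open>For a single time, a shift by x / \<tau> can only be bounded trivially, by the order of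
  p x in the mean. The block average changes by at most 36 x in the mean, without the factor p. The
  majorant \<open>E\<close> does not depend on d and so serves all admissible shifts at
  once.\<close>

lemma sliding_disc_variation:
  fixes p \<tau> K :: nat
  assumes K: "1 \<le> K" "K \<le> p" "p < 2 * K" and \<tau>: "0 < \<tau>" and s: "0 \<le> s" and x: "0 < x" "x \<le> 1"
    and big: "1000 * real K ^ 3 * (s + 1) \<le> \<rho>" and \<tau>_big: "52 * \<rho> \<le> real \<tau> * x"
    and L1: "\<And>c. integral {0..1} (\<lambda>a. \<bar>wdisc y \<rho> (p * \<tau>) (a + c)\<bar>) \<le> 2 * s"
    and L2: "\<And>c. integral {0..1} (\<lambda>a. \<bar>wdisc y \<rho> ((p + 1) * \<tau>) (a + c)\<bar>) \<le> 2 * s"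
  obtains E where "bdd_borel E" "\<And>a. 0 \<le> E a" "integral {0..1} E \<le> 36 * x"
    "\<And>a d. 0 \<le> d \<Longrightarrow> d \<le> x / real \<tau> \<Longrightarrow>
      \<bar>sliding_disc y \<rho> (p * \<tau>) ((p + 1) * \<tau>) (a + d) - sliding_disc y \<rho> (p * \<tau>) ((p + 1) * \<tau>) a\<bar> \<le> real \<tau> * E a"
proof -
  define n1 n2 where "n1 = p * \<tau>" and "n2 = (p + 1) * \<tau>"
  define w1 w2 l d0 where "w1 = \<rho> / real n1" and "w2 = \<rho> / real n2" and "l = \<rho> / real n1 - \<rho> / real n2"
    and "d0 = x / real \<tau>"
  let ?K = "real K" and ?T = "real \<tau>" and ?P = "real p"
  have r: "1 \<le> ?K" "1 \<le> ?P" "?P + 1 \<le> 2 * ?K" "0 < ?T" "1 \<le> ?T" "?K \<le> ?P" using K \<tau> by auto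
  have K3: "1 \<le> ?K^3" "?K\<^sup>2 \<le> ?K^3" using r(1) by (auto simp: power_increasing)
  have \<rho>K: "1000 * ?K^3 \<le> \<rho>" and \<rho>: "0 < \<rho>"
  proof -
    have "1000 * ?K^3 * 1 \<le> 1000 * ?K^3 * (s + 1)" using s by (intro mult_left_mono) auto
    then show "1000 * ?K^3 \<le> \<rho>" using big by linarith
    then show "0 < \<rho>" using K3 by linarith
  qed
  have n: "0 < n1" "n1 \<le> n2" "n2 - n1 = \<tau>" "n2 = n1 + \<tau>" using K \<tau> by (auto simp: n1_def n2_def)
  have nr: "real n1 = ?P * ?T" "real n2 = (?P + 1) * ?T" by (auto simp: n1_def n2_def algebra_simps)
  have l_eq: "l = \<rho> / (?P * (?P + 1) * ?T)"
  proof -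
    have "\<rho> / (P * T) - \<rho> / (Q * T) = \<rho> * (Q - P) / (P * Q * T)" if "0 < P" "0 < T" "0 < Q" for P Q T :: real
      using that by (simp add: divide_simps) (simp add: algebra_simps)
    from this[of ?P ?T "?P + 1"] show ?thesis unfolding l_def nr using r by simp
  qed
  have l0: "0 \<le> l" using l_eq r \<rho> by simp
  have d0: "0 \<le> d0" using x by (simp add: d0_def)
  have PQ: "?P * (?P + 1) \<le> 4 * ?K\<^sup>2"
  proof -
    have "?P * (?P + 1) \<le> (2 * ?K) * (2 * ?K)" using r by (intro mult_mono) auto
    then show ?thesis by (simp add: power2_eq_square)
  qed
  have d0l: "d0 \<le> l"
  proof -
    have "x * (?P * (?P + 1)) \<le> 1 * (?P * (?P + 1))" using x by (intro mult_right_mono) auto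
    also have "\<dots> \<le> 4 * ?K\<^sup>2" using PQ by simp
    also have "\<dots> \<le> \<rho>" using \<rho>K K3 by linarith
    finally have "x \<le> \<rho> / (?P * (?P + 1))" using r by (simp add: pos_le_divide_eq)
    then have "x / ?T \<le> \<rho> / (?P * (?P + 1)) / ?T" using r by (intro divide_right_mono) auto
    then show ?thesis unfolding l_eq d0_def by (simp add: mult_ac)
  qed
  have Tl: "?T * l \<le> \<rho> / ?K\<^sup>2"
  proof -
    have "?T * l = \<rho> / (?P * (?P + 1))" unfolding l_eq using r by simp
    also have "\<dots> \<le> \<rho> / (?K * ?K)" using r \<rho> by (intro divide_left_mono mult_mono mult_pos_pos) auto
    finally show ?thesis by (simp add: power2_eq_square)
  qed
  \<comment> \<open>The increments left by the two counting estimates are split into increments over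
    l, controlled by transport, and increments over d0, controlled trivially.\<close>
  define W where "W = (\<lambda>a. \<bar>disc y n2 (a + w2 + l) - disc y n2 (a + w2)\<bar> + \<bar>disc y n2 (a + w1 + d0) - disc y n2 (a + w1)\<bar>
     + \<bar>disc y n1 (a + w2 + l) - disc y n1 (a + w2)\<bar> + \<bar>disc y n1 (a + w2 + d0) - disc y n1 (a + w2)\<bar>)"
  define E where "E = (\<lambda>a. 3 * x + 8 * x\<^sup>2 * ?K^3 / \<rho> + 2 * ?K * (l + d0) + (4 * ?K\<^sup>2 * x / \<rho> + 1 / ?T) * W a)"
  have bD: "bdd_borel (\<lambda>a. \<bar>disc y n (a + c + d) - disc y n (a + c)\<bar>)" for n c d
    using bdd_borel_disc_shift[of y n "c + d"] by (auto simp: add.assoc)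
  have bW: "bdd_borel W" unfolding W_def by (intro bdd_borel_add bD)
  have w2l: "w2 + l = w1" by (simp add: w1_def w2_def l_def)
  show ?thesis
  proof (rule that[of E])
    show "bdd_borel E" unfolding E_def using bW by auto
    show "0 \<le> E a" for a
      unfolding E_def W_def using x \<rho> l0 d0 r by (intro add_nonneg_nonneg mult_nonneg_nonneg divide_nonneg_nonneg) auto
    have B2: "integral {0..1} (\<lambda>a. \<bar>disc y n2 (a + w2 + l) - disc y n2 (a + w2)\<bar>) \<le> 2 * ?T * l + 8 * real (p + 1) * s"
      using integral_abs_disc_increment_later[of p \<tau> \<rho> y s w2] K \<tau> \<rho> s L1 L2
      unfolding n1_def n2_def l_def by simp
    have B1: "integral {0..1} (\<lambda>a. \<bar>disc y n1 (a + w2 + l) - disc y n1 (a + w2)\<bar>)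
       \<le> 2 * (2 * ?T * l + 8 * real (p + 1) * s) + 2 * ?T * l"
      by (rule integral_abs_disc_increment_earlier[OF n(4) l0 B2])
    have iW: "integral {0..1} W \<le> (2 * ?T * l + 8 * real (p + 1) * s) + 2 * real n2 * d0
        + (2 * (2 * ?T * l + 8 * real (p + 1) * s) + 2 * ?T * l) + 2 * real n1 * d0"
      unfolding W_def
      by (intro integral_add_le B1 B2 bD bdd_borel_add integral_abs_disc_increment_le d0)
    also have "\<dots> \<le> 8 * (?T * l) + 48 * ?K * s + 8 * ?K * x"
    proof -
      have "real (p + 1) * s \<le> 2 * ?K * s" using r s by (intro mult_right_mono) auto
      moreover have "real n2 * d0 = (?P + 1) * x" "real n1 * d0 = ?P * x" unfolding nr d0_def using r by auto
      moreover have "(?P + 1) * x \<le> 2 * ?K * x" "?P * x \<le> 2 * ?K * x" using r x by (auto intro!: mult_right_mono)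
      ultimately show ?thesis by (simp add: algebra_simps)
    qed
    finally have iW': "integral {0..1} W \<le> 8 * (?T * l) + 48 * ?K * s + 8 * ?K * x" .
    have "integral {0..1} E = 3 * x + 8 * x\<^sup>2 * ?K^3 / \<rho> + 2 * ?K * (l + d0) + (4 * ?K\<^sup>2 * x / \<rho> + 1 / ?T) * integral {0..1} W"
      unfolding E_def using bW by (subst integral_add) auto
    also have "\<dots> \<le> 36 * x"
      by (rule variation_integral_numeric[OF r(1) s x r(5) big \<tau>_big Tl d0_def iW'])
    finally show "integral {0..1} E \<le> 36 * x" .
    fix a d :: real
    assume d: "0 \<le> d" "d \<le> x / ?T"
    then have d': "d \<le> d0" by (simp add: d0_def)
    have diff: "sliding_disc y \<rho> n1 n2 (a + d) - sliding_disc y \<rho> n1 n2 a =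
      (\<Sum>n\<in>{n1<..n2}. disc y n (a + d + \<rho> / real n) - disc y n (a + \<rho> / real n))"
      unfolding sliding_disc_def sum_subtractf ..
    have Wu: "\<bar>disc y n2 (a + w1 + d0) - disc y n2 (a + w2)\<bar> \<le> W a"
      unfolding W_def using w2l by (simp add: add.assoc)
    have Wl: "\<bar>disc y n1 (a + w1) - disc y n1 (a + w2 + d0)\<bar> \<le> W a"
      unfolding W_def using w2l by (simp add: add.assoc)
    have "sliding_disc y \<rho> n1 n2 (a + d) - sliding_disc y \<rho> n1 n2 a \<le> ?T * E a"
    proof -
      note sliding_disc_upper[OF n(1,2) \<rho> d(1) d', of y a, folded l_def w1_def w2_def]
      also have "(d * (real n2)\<^sup>2 / \<rho> + 1) * (real n2 * (l + d0) + (disc y n2 (a + w1 + d0) - disc y n2 (a + w2))) -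
         real (n2 - n1) * (real n1 * d) \<le> ?T * E a"
        unfolding E_def n(3) nr by (rule sliding_upper_numeric[OF r(2,3,4) \<rho> d(1) d' d0_def l_eq Wu])
      finally show ?thesis unfolding diff .
    qed
    moreover have "sliding_disc y \<rho> n1 n2 (a + d) - sliding_disc y \<rho> n1 n2 a \<ge> - (?T * E a)"
    proof -
      have "(d * (real n1)\<^sup>2 / \<rho> - 1) * (real n1 * (l - d0) + (disc y n1 (a + w1) - disc y n1 (a + w2 + d0))) -
         real (n2 - n1) * (real n2 * d) \<ge> - (?T * E a)"
        unfolding E_def n(3) nr by (rule sliding_lower_numeric[OF r(2,3,4) \<rho> d(1) d' d0_def l_eq Wl])
      moreover note sliding_disc_lower[OF n(1,2) \<rho> d(1) d' d0l[unfolded l_def], of y a, folded l_def w1_def w2_def]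
      ultimately show ?thesis unfolding diff by linarith
    qed
    ultimately show "\<bar>sliding_disc y \<rho> (p * \<tau>) ((p + 1) * \<tau>) (a + d) - sliding_disc y \<rho> (p * \<tau>) ((p + 1) * \<tau>) a\<bar> \<le> ?T * E a"
      unfolding n1_def n2_def by linarith
  qed
qed

section \<open>Growth of the maximum over time\<close>

text \<open>Only the first and the last quarter enter: the elapsed times in them differ by at least half of
  the total time, which is what separates the slopes in \<open>level_gap\<close>.\<close>

primrec tmax :: "(nat \<Rightarrow> real \<Rightarrow> real) \<Rightarrow> nat \<Rightarrow> nat \<Rightarrow> real \<Rightarrow> real" where
  "tmax g 0 l a = g l a"
| "tmax g (Suc k) l a = max (tmax g k (4 * l) a) (tmax g k (4 * l + 3) a)"

lemma tmax_le: "(\<And>j. g j a \<le> s) \<Longrightarrow> tmax g k l a \<le> s"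
  by (induction k arbitrary: l) auto

lemma bdd_borel_tmax [simp, intro]:
  assumes "\<And>j. bdd_borel (g j)" shows "bdd_borel (tmax g k l)"
proof (induction k arbitrary: l)
  case 0
  have "tmax g 0 l = g l" by auto
  then show ?case using assms by simp
next
  case (Suc k)
  have "tmax g (Suc k) l = (\<lambda>a. max (tmax g k (4 * l) a) (tmax g k (4 * l + 3) a))" by auto
  then show ?case using Suc by auto
qed

text \<open>A maximum inherits a common lower bound on the increments of its entries; the leaves
  under node \<open>l\<close> at height \<open>k\<close> have indices in the stated range.\<close>

lemma tmax_increment_ge:
  assumes "\<And>j. l * 4 ^ k \<le> j \<Longrightarrow> j < (l + 1) * 4 ^ k \<Longrightarrow> lo \<le> g j a' - g j a"
  shows "lo \<le> tmax g k l a' - tmax g k l a"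
  using assms
proof (induction k arbitrary: l)
  case (Suc k)
  have "lo \<le> tmax g k (4 * l) a' - tmax g k (4 * l) a"
    by (rule Suc.IH, rule Suc.prems) (auto simp: algebra_simps)
  moreover have "lo \<le> tmax g k (4 * l + 3) a' - tmax g k (4 * l + 3) a"
    by (rule Suc.IH, rule Suc.prems) (auto simp: algebra_simps)
  ultimately show ?case by (auto simp: max_def)
qed simp

lemma tmax_increment_le:
  assumes "\<And>j. l * 4 ^ k \<le> j \<Longrightarrow> j < (l + 1) * 4 ^ k \<Longrightarrow> g j a' - g j a \<le> hi"
  shows "tmax g k l a' - tmax g k l a \<le> hi"
  using tmax_increment_ge[of l k "- hi" g a a'] assms by force

text \<open>Since max A B = (A + B + |A - B|) / 2, every level adds half of the mean gap h, starting
  from leaves of mean 0.\<close>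

lemma integral_tmax_ge:
  assumes b: "\<And>j. bdd_borel (g j)" and zero: "\<And>j. integral {0..1} (g j) = 0"
    and gap: "\<And>k l. k < \<kappa> \<Longrightarrow> l < 4 ^ (\<kappa> - Suc k) \<Longrightarrow>
      h \<le> integral {0..1} (\<lambda>a. \<bar>tmax g k (4 * l) a - tmax g k (4 * l + 3) a\<bar>)"
    and "k \<le> \<kappa>" "l < 4 ^ (\<kappa> - k)"
  shows "real k * (h / 2) \<le> integral {0..1} (tmax g k l)"
  using \<open>k \<le> \<kappa>\<close> \<open>l < 4 ^ (\<kappa> - k)\<close>
proof (induction k arbitrary: l)
  case 0
  have "tmax g 0 l = g l" by auto
  then show ?case using zero by simp
next
  case (Suc k)
  have four: "(4::nat) ^ (\<kappa> - k) = 4 * 4 ^ (\<kappa> - Suc k)"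
    using Suc.prems by (simp add: Suc_diff_Suc flip: power_Suc)
  define A B where "A = tmax g k (4 * l)" and "B = tmax g k (4 * l + 3)"
  have bA: "bdd_borel A" "bdd_borel B" unfolding A_def B_def using b by auto
  have IA: "real k * (h / 2) \<le> integral {0..1} A" "real k * (h / 2) \<le> integral {0..1} B"
    unfolding A_def B_def by (rule Suc.IH; use Suc.prems four in simp)+
  have step: "tmax g (Suc k) l = (\<lambda>a. (1/2) * (A a + B a + \<bar>A a - B a\<bar>))"
    by (auto simp: A_def B_def max_def field_simps)
  have "integral {0..1} (tmax g (Suc k) l) = (1/2) * (integral {0..1} A + integral {0..1} B + integral {0..1} (\<lambda>a. \<bar>A a - B a\<bar>))"
  proof -
    have "integral {0..1} (\<lambda>a. A a + B a + \<bar>A a - B a\<bar>) =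
      integral {0..1} (\<lambda>a. A a + B a) + integral {0..1} (\<lambda>a. \<bar>A a - B a\<bar>)"
      using bA by (intro integral_add) auto
    also have "integral {0..1} (\<lambda>a. A a + B a) = integral {0..1} A + integral {0..1} B"
      using bA by (intro integral_add) auto
    finally show ?thesis unfolding step by simp
  qed
  then show ?case
    using IA gap[of k l] Suc.prems unfolding A_def[symmetric] B_def[symmetric]
    by (simp add: field_simps del: tmax.simps)
qed

section \<open>Leaves on intervals without births\<close>

lemma disc_increment_no_births:
  fixes N n :: nat
  assumes y01: "\<And>i. 0 \<le> y i \<and> y i < 1" and "N \<le> n"
    and free: "\<And>i. N < i \<Longrightarrow> i \<le> n \<Longrightarrow> \<not> (u < y i \<and> y i < v)"
    and uv: "0 \<le> u" "v \<le> 1" "u < a" "a \<le> a'" "a' < v"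
  shows "disc y n a' - disc y n a = disc y N a' - disc y N a - (real n - real N) * (a' - a)"
proof -
  \<comment> \<open>A point at or left of \<open>u\<close> is already passed by both
    \<open>a\<close> and \<open>a'\<close>, one at or right of \<open>v\<close> by neither, so late
    points contribute to the expected count only.\<close>
  have same: "\<lfloor>a' - y i\<rfloor> - \<lfloor>a - y i\<rfloor> = 0" if "i \<in> {N<..n}" for i
  proof (cases "y i \<le> u")
    case True
    then have "\<lfloor>a' - y i\<rfloor> = 0" "\<lfloor>a - y i\<rfloor> = 0"
      using uv y01[of i] by (auto simp: floor_eq_iff)
    then show ?thesis by simp
  next
    case False
    then have "v \<le> y i" using free[of i] that by auto
    then have "\<lfloor>a' - y i\<rfloor> = -1" "\<lfloor>a - y i\<rfloor> = -1"
      using uv y01[of i] by (auto simp: floor_eq_iff)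
    then show ?thesis by simp
  qed
  have "{1..n} = {1..N} \<union> {N<..n}" using \<open>N \<le> n\<close> by auto
  then have "cnt y n a a' = cnt y N a a' + (\<Sum>i\<in>{N<..n}. \<lfloor>a' - y i\<rfloor> - \<lfloor>a - y i\<rfloor>)"
    unfolding cnt_def by (metis (no_types, lifting) finite_atLeastAtMost finite_greaterThanAtMost ivl_disj_int_two(8) sum.union_disjoint)
  also have "(\<Sum>i\<in>{N<..n}. \<lfloor>a' - y i\<rfloor> - \<lfloor>a - y i\<rfloor>) = 0" using same by (intro sum.neutral) auto
  finally show ?thesis unfolding disc_diff by (simp add: algebra_simps)
qed

text \<open>The sign \<open>e\<close> is 1 for an upper and -1 for a lower bound on
  \<open>wdisc\<close>, so that both cases share one argument. Averaging over T times makes the term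
  with the sliding right end vary slowly in \<open>a\<close>.\<close>

definition leaf :: "real \<Rightarrow> (nat \<Rightarrow> real) \<Rightarrow> real \<Rightarrow> nat \<Rightarrow> nat \<Rightarrow> nat \<Rightarrow> real \<Rightarrow> real" where
  "leaf e y \<rho> T b j a = e * (\<Sum>n\<in>{(b + j) * T<..(b + j + 1) * T}. wdisc y \<rho> n a) / real T"

lemma bdd_borel_leaf [simp, intro]: "bdd_borel (leaf e y \<rho> T b j)"
  unfolding leaf_def[abs_def] by (intro bdd_borel_divide bdd_borel_cmult bdd_borel_sum bdd_borel_wdisc)

lemma integral_leaf: "integral {0..1} (leaf e y \<rho> T b j) = 0"
  unfolding leaf_def[abs_def] by (simp add: integral_sum integral_wdisc)

lemma leaf_le:
  assumes "\<And>n a. n0 \<le> n \<Longrightarrow> e * wdisc y \<rho> n a \<le> s" "n0 \<le> b * T" "0 < T"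
  shows "leaf e y \<rho> T b j a \<le> s"
proof -
  have "(\<Sum>n\<in>{(b + j) * T<..(b + j + 1) * T}. e * wdisc y \<rho> n a) \<le> (\<Sum>n\<in>{(b + j) * T<..(b + j + 1) * T}. s)"
  proof (intro sum_mono assms(1))
    fix n assume "n \<in> {(b + j) * T<..(b + j + 1) * T}"
    moreover have "n0 \<le> (b + j) * T" by (rule order_trans[OF assms(2)]) simp
    ultimately show "n0 \<le> n" by auto
  qed
  also have "\<dots> = real T * s" by simp
  finally show ?thesis using \<open>0 < T\<close> unfolding leaf_def by (simp add: sum_distrib_left pos_divide_le_eq mult.commute)
qed

text \<open>On an interval that receives no new point during the times considered, a leaf is, up to the
  variation of the sliding part, affine with slope the mean elapsed time.\<close>

lemma leaf_increment:
  fixes N T b j j0 :: nat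
  assumes y01: "\<And>i. 0 \<le> y i \<and> y i < 1" and T: "0 < T"
    and j: "N = (b + j0) * T" "j0 \<le> j"
    and free: "\<And>i. N < i \<Longrightarrow> i \<le> (b + j + 1) * T \<Longrightarrow> \<not> (u < y i \<and> y i < v)"
    and uv: "0 \<le> u" "v \<le> 1" "u < a" "a \<le> a'" "a' < v"
    and var: "\<bar>sliding_disc y \<rho> ((b + j) * T) ((b + j + 1) * T) a' - sliding_disc y \<rho> ((b + j) * T) ((b + j + 1) * T) a\<bar> \<le> real T * E"
  obtains z where "leaf e y \<rho> T b j a' - leaf e y \<rho> T b j a = e * z"
    "z \<ge> - (disc y N a' - disc y N a) + real ((j - j0) * T) * (a' - a) - E"
    "z \<le> - (disc y N a' - disc y N a) + real ((j - j0 + 1) * T) * (a' - a) + E"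
proof -
  let ?B = "{(b + j) * T<..(b + j + 1) * T}"
  \<comment> \<open>\<open>V\<close> is the contribution of the sliding right end; \<open>U\<close>
    is the increment of \<open>disc\<close> at the time \<open>N\<close> from which elapsed time is
    measured.\<close>
  define V where "V = sliding_disc y \<rho> ((b + j) * T) ((b + j + 1) * T) a' - sliding_disc y \<rho> ((b + j) * T) ((b + j + 1) * T) a"
  define U where "U = disc y N a' - disc y N a"
  have cardB: "card ?B = T" by (simp add: algebra_simps)
  have NB: "N \<le> (b + j) * T" using j by simp
  have "leaf e y \<rho> T b j a' - leaf e y \<rho> T b j a = e * ((V - (\<Sum>n\<in>?B. disc y n a' - disc y n a)) / real T)"
    unfolding leaf_def V_def sliding_disc_def wdisc_def sum_subtractf
    by (simp add: algebra_simps diff_divide_distrib add_divide_distrib)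
  also have "(\<Sum>n\<in>?B. disc y n a' - disc y n a) = (\<Sum>n\<in>?B. U - (real n - real N) * (a' - a))"
  proof (rule sum.cong)
    fix n assume n: "n \<in> ?B"
    show "disc y n a' - disc y n a = U - (real n - real N) * (a' - a)"
      unfolding U_def
      by (rule disc_increment_no_births[OF y01 _ _ uv]) (use n NB free in auto)
  qed simp
  finally have eq: "leaf e y \<rho> T b j a' - leaf e y \<rho> T b j a =
     e * ((V - (\<Sum>n\<in>?B. U - (real n - real N) * (a' - a))) / real T)" .
  have lower: "(\<Sum>n\<in>?B. U - (real n - real N) * (a' - a)) \<le> real T * (U - real ((j - j0) * T) * (a' - a))"
  proof -
    have "(\<Sum>n\<in>?B. U - (real n - real N) * (a' - a)) \<le> (\<Sum>n\<in>?B. U - real ((j - j0) * T) * (a' - a))"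
    proof (intro sum_mono diff_left_mono mult_right_mono)
      fix n assume "n \<in> ?B"
      moreover have "(b + j) * T = N + (j - j0) * T" using j by (simp add: algebra_simps diff_mult_distrib)
      ultimately show "real ((j - j0) * T) \<le> real n - real N"
        by (metis add.commute greaterThanAtMost_iff le_diff_eq less_imp_le of_nat_add of_nat_le_iff)
    qed (use uv in auto)
    then show ?thesis using cardB by simp
  qed
  have upper: "(\<Sum>n\<in>?B. U - (real n - real N) * (a' - a)) \<ge> real T * (U - real ((j - j0 + 1) * T) * (a' - a))"
  proof -
    have "(\<Sum>n\<in>?B. U - (real n - real N) * (a' - a)) \<ge> (\<Sum>n\<in>?B. U - real ((j - j0 + 1) * T) * (a' - a))"
    proof (intro sum_mono diff_left_mono mult_right_mono)
      fix n assume "n \<in> ?B"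
      moreover obtain i where "j = j0 + i" using j(2) le_Suc_ex by blast
      then have "(b + j + 1) * T = N + (j - j0 + 1) * T" using j(1) by (simp add: algebra_simps)
      ultimately have "n \<le> N + (j - j0 + 1) * T" by auto
      then have "real n \<le> real N + real ((j - j0 + 1) * T)" by (metis of_nat_add of_nat_le_iff)
      then show "real n - real N \<le> real ((j - j0 + 1) * T)" by simp
    qed (use uv in auto)
    then show ?thesis using cardB by simp
  qed
  have V: "- (real T * E) \<le> V" "V \<le> real T * E" using var unfolding V_def by auto
  show ?thesis
  proof (rule that[OF eq])
    have "real T * (- U + real ((j - j0) * T) * (a' - a) - E) \<le> V - (\<Sum>n\<in>?B. U - (real n - real N) * (a' - a))"
      using lower V by (simp add: algebra_simps)
    then show "(V - (\<Sum>n\<in>?B. U - (real n - real N) * (a' - a))) / real T \<ge> - (disc y N a' - disc y N a) + real ((j - j0) * T) * (a' - a) - E"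
      using T unfolding U_def by (subst pos_le_divide_eq) (simp_all add: mult.commute)
    have "V - (\<Sum>n\<in>?B. U - (real n - real N) * (a' - a)) \<le> real T * (- U + real ((j - j0 + 1) * T) * (a' - a) + E)"
      using upper V by (simp add: algebra_simps)
    then show "(V - (\<Sum>n\<in>?B. U - (real n - real N) * (a' - a))) / real T \<le> - (disc y N a' - disc y N a) + real ((j - j0 + 1) * T) * (a' - a) + E"
      using T unfolding U_def by (subst pos_divide_le_eq) (simp_all add: mult.commute)
  qed
qed

text \<open>On an interval without births, and up to the sign \<open>e\<close> and the errors
  \<open>E\<close>, leaf increments over a distance d are - U plus at most 4 q d in the first
  quarter and - U plus at least 12 q d in the last. So the difference of the two maxima changes by
  at least 8 q d, up to errors, between mirror points at distance d. At most 17 q pieces then give 2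
  / 17 in total.\<close>

lemma level_gap:
  fixes k l T b q :: nat
  assumes y01: "\<And>i. 0 \<le> y i \<and> y i < 1" and e: "e = 1 \<or> e = -1" and T: "0 < T"
    and q: "4 ^ Suc k * T = 16 * q"
    and E: "\<And>j. l * 4 ^ Suc k \<le> j \<Longrightarrow> j < (l + 1) * 4 ^ Suc k \<Longrightarrow> bdd_borel (E j)"
      "\<And>j a. l * 4 ^ Suc k \<le> j \<Longrightarrow> j < (l + 1) * 4 ^ Suc k \<Longrightarrow> 0 \<le> E j a"
      "\<And>j. l * 4 ^ Suc k \<le> j \<Longrightarrow> j < (l + 1) * 4 ^ Suc k \<Longrightarrow> integral {0..1} (E j) \<le> B"
    and var: "\<And>j a d. l * 4 ^ Suc k \<le> j \<Longrightarrow> j < (l + 1) * 4 ^ Suc k \<Longrightarrow> 0 \<le> d \<Longrightarrow> d \<le> 1 / real q \<Longrightarrow>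
      \<bar>sliding_disc y \<rho> ((b + j) * T) ((b + j + 1) * T) (a + d) - sliding_disc y \<rho> ((b + j) * T) ((b + j + 1) * T) a\<bar> \<le> real T * E j a"
  defines "g \<equiv> leaf e y \<rho> T b"
  shows "2 / 17 - 4 ^ Suc k * B \<le> integral {0..1} (\<lambda>a. \<bar>tmax g k (4 * l) a - tmax g k (4 * l + 3) a\<bar>)"
proof -
  define j0 where "j0 = l * 4 ^ Suc k"
  define N where "N = (b + j0) * T"
  define J where "J = {j0..<(l + 1) * 4 ^ Suc k}"
  define H where "H = (\<lambda>a. \<Sum>j\<in>J. E j a)"
  define D where "D = (\<lambda>a. tmax g k (4 * l) a - tmax g k (4 * l + 3) a)"
  \<comment> \<open>The births during the 16 q times of the node, and a grid of mesh 1 / q that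
    makes each free interval short enough for \<open>var\<close>.\<close>
  define Z where "Z = y ` {N<..N + 16 * q} \<union> (\<lambda>i. real i / real q) ` {1..<q}"
  have q0: "0 < q" using q T by (cases q) auto
  have cardJ: "card J = 4 ^ Suc k" by (simp add: J_def j0_def algebra_simps)
  have EJ: "bdd_borel (E j)" "0 \<le> E j a" "integral {0..1} (E j) \<le> B" if "j \<in> J" for j a
    using E[of j] that by (auto simp: J_def j0_def)
  have bH: "bdd_borel H" unfolding H_def using EJ by auto
  have H0: "0 \<le> H a" for a unfolding H_def using EJ by (intro sum_nonneg) auto
  have iH: "integral {0..1} H \<le> 4 ^ Suc k * B"
    unfolding H_def using integral_sum_le[of J E 0 1 "\<lambda>_. B"] EJ cardJ by (auto simp: J_def)
  have bg: "bdd_borel (g j)" for j unfolding g_def by auto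
  have bD: "bdd_borel D" unfolding D_def using bg by auto
  have "4 ^ k * T = 4 * q" using q by (simp add: mult.commute)
  then have qr: "real (4 ^ k * T) = 4 * real q" by (metis of_nat_mult of_nat_numeral)
  have piece: "2 * real q * (v - u)\<^sup>2 - integral {u..v} H \<le> integral {u..v} (\<lambda>a. \<bar>D a\<bar>)"
    if uv: "0 \<le> u" "u \<le> v" "v \<le> 1" and Zfree: "{u<..<v} \<inter> Z = {}" for u v
  proof -
    have short: "v - u \<le> 1 / real q"
    proof (rule ccontr)
      assume "\<not> v - u \<le> 1 / real q"
      then have long: "u * real q + 1 < v * real q" using q0 by (simp add: field_simps)
      \<comment> \<open>The first grid index to the right of \<open>u\<close>; its grid point would
        lie in the free interval.\<close>
      define i where "i = nat \<lfloor>u * real q\<rfloor> + 1"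
      have "0 \<le> u * real q" using uv by simp
      then have i: "u * real q < real i" "real i \<le> u * real q + 1"
        unfolding i_def by linarith+
      have "v * real q \<le> real q" using mult_right_mono[of v 1 "real q"] uv by simp
      then have "i < q" using i long by linarith
      moreover have "u < real i / real q" "real i / real q < v" using i long q0 by (auto simp: field_simps)
      moreover have "1 \<le> i" by (simp add: i_def)
      ultimately have "real i / real q \<in> {u<..<v} \<inter> Z" by (auto simp: Z_def)
      then show False using Zfree by auto
    qed
    have free: "\<not> (u < y i \<and> y i < v)" if "N < i" "i \<le> N + 16 * q" for i
      using Zfree that by (auto simp: Z_def)
    have pair: "8 * real q * (u + v - 2 * a) - H a \<le> \<bar>D a\<bar> + \<bar>D (u + v - a)\<bar>"
      if a: "u < a" "a < (u + v) / 2" for a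
    proof -
      define a' where "a' = u + v - a"
      define d where "d = a' - a"
      have aa: "u < a" "a \<le> a'" "a' < v" using a by (auto simp: a'_def field_simps)
      have d: "0 \<le> d" "d \<le> 1 / real q" using aa short by (auto simp: d_def)
      define U where "U = disc y N a' - disc y N a"
      have incr: "\<exists>z. g j a' - g j a = e * z \<and> z \<ge> - U + real ((j - j0) * T) * d - E j a \<and>
         z \<le> - U + real ((j - j0 + 1) * T) * d + E j a" if j: "j \<in> J" for j
      proof -
        have j': "l * 4 ^ Suc k \<le> j" "j < (l + 1) * 4 ^ Suc k" "j0 \<le> j" using j by (auto simp: J_def j0_def)
        have fr: "\<not> (u < y i \<and> y i < v)" if i: "N < i" "i \<le> (b + j + 1) * T" for i
        proof (rule free[OF i(1)])
          have "(b + j + 1) * T \<le> (b + (l + 1) * 4 ^ Suc k) * T" using j' by (intro mult_right_mono) auto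
          also have "\<dots> = N + 4 ^ Suc k * T" by (simp add: N_def j0_def algebra_simps)
          also have "\<dots> = N + 16 * q" by (simp only: q)
          finally show "i \<le> N + 16 * q" using i(2) by (rule order_trans[rotated])
        qed
        have v': "\<bar>sliding_disc y \<rho> ((b + j) * T) ((b + j + 1) * T) a' - sliding_disc y \<rho> ((b + j) * T) ((b + j + 1) * T) a\<bar> \<le> real T * E j a"
          using var[OF j'(1,2) d, of a] by (simp add: d_def)
        obtain z where "leaf e y \<rho> T b j a' - leaf e y \<rho> T b j a = e * z"
          "z \<ge> - (disc y N a' - disc y N a) + real ((j - j0) * T) * (a' - a) - E j a"
          "z \<le> - (disc y N a' - disc y N a) + real ((j - j0 + 1) * T) * (a' - a) + E j a"
          by (rule leaf_increment[OF y01 T N_def j'(3) fr uv(1,3) aa v'])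
        then show ?thesis unfolding g_def U_def d_def by blast
      qed
      have EH: "E j a + E j' a \<le> H a" if "j \<in> J" "j' \<in> J" "j \<noteq> j'" for j j'
      proof -
        have "E j a + E j' a = (\<Sum>j\<in>{j, j'}. E j a)" using that by simp
        also have "\<dots> \<le> H a" unfolding H_def using that EJ by (intro sum_mono2) (auto simp: J_def)
        finally show ?thesis .
      qed
      define J1 J4 where "J1 = {4 * l * 4 ^ k..<(4 * l + 1) * 4 ^ k}" and "J4 = {(4 * l + 3) * 4 ^ k..<(4 * l + 3 + 1) * 4 ^ k}"
      \<comment> \<open>The quarters are disjoint, so their separate error sums together stay below
        \<open>H a\<close>.\<close>
      define H1 H4 where "H1 = (\<Sum>j\<in>J1. E j a)" and "H4 = (\<Sum>j\<in>J4. E j a)"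
      have sub: "J1 \<subseteq> J" "J4 \<subseteq> J" unfolding J1_def J4_def J_def j0_def by (auto simp: algebra_simps)
      have disj: "J1 \<inter> J4 = {}" unfolding J1_def J4_def by (auto simp: algebra_simps)
      have fin: "finite J1" "finite J4" "finite J" by (auto simp: J1_def J4_def J_def)
      have HH: "H1 + H4 \<le> H a"
      proof -
        have "H1 + H4 = (\<Sum>j\<in>J1 \<union> J4. E j a)" unfolding H1_def H4_def using fin disj by (simp add: sum.union_disjoint)
        also have "\<dots> \<le> H a" unfolding H_def using sub fin EJ by (intro sum_mono2) auto
        finally show ?thesis .
      qed
      have E1: "E j a \<le> H1" if "j \<in> J1" for j
        unfolding H1_def using that fin sub EJ by (intro member_le_sum) auto
      have E4: "E j a \<le> H4" if "j \<in> J4" for j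
        unfolding H4_def using that fin sub EJ by (intro member_le_sum) auto
      have s1: "real ((j - j0 + 1) * T) * d \<le> 4 * real q * d" if "j \<in> J1" for j
      proof -
        have "j - j0 + 1 \<le> 4 ^ k" using that by (auto simp: J1_def j0_def)
        then have "(j - j0 + 1) * T \<le> 4 ^ k * T" by (rule mult_right_mono) simp
        then have "real ((j - j0 + 1) * T) \<le> 4 * real q" unfolding qr[symmetric] of_nat_le_iff .
        then show ?thesis using d by (intro mult_right_mono)
      qed
      have s4: "12 * real q * d \<le> real ((j - j0) * T) * d" if "j \<in> J4" for j
      proof -
        have "3 * 4 ^ k \<le> j - j0" using that by (auto simp: J4_def j0_def algebra_simps)
        then have "3 * 4 ^ k * T \<le> (j - j0) * T" by (rule mult_right_mono) simp
        then have "real (3 * (4 ^ k * T)) \<le> real ((j - j0) * T)" unfolding of_nat_le_iff by (simp add: mult.assoc)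
        then have "12 * real q \<le> real ((j - j0) * T)" using qr by simp
        then show ?thesis using d by (intro mult_right_mono)
      qed
      \<comment> \<open>The common term \<open>U\<close>, about which nothing is known, cancels in
        the difference of the two maxima.\<close>
      have "8 * real q * d - H a \<le> \<bar>D a' - D a\<bar>"
        using e
      proof
        assume e: "e = 1"
        have "tmax g k (4 * l) a' - tmax g k (4 * l) a \<le> - U + 4 * real q * d + H1"
        proof (rule tmax_increment_le)
          fix j assume "4 * l * 4 ^ k \<le> j" "j < (4 * l + 1) * 4 ^ k"
          then have j: "j \<in> J1" by (auto simp: J1_def)
          with incr[of j] sub s1[OF j] E1[OF j] e show "g j a' - g j a \<le> - U + 4 * real q * d + H1" by fastforce
        qed
        moreover have "- U + 12 * real q * d - H4 \<le> tmax g k (4 * l + 3) a' - tmax g k (4 * l + 3) a"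
        proof (rule tmax_increment_ge)
          fix j assume "(4 * l + 3) * 4 ^ k \<le> j" "j < (4 * l + 3 + 1) * 4 ^ k"
          then have j: "j \<in> J4" by (auto simp: J4_def)
          with incr[of j] sub s4[OF j] E4[OF j] e show "- U + 12 * real q * d - H4 \<le> g j a' - g j a" by fastforce
        qed
        ultimately show ?thesis using HH unfolding D_def by linarith
      next
        assume e: "e = -1"
        have "U - 4 * real q * d - H1 \<le> tmax g k (4 * l) a' - tmax g k (4 * l) a"
        proof (rule tmax_increment_ge)
          fix j assume "4 * l * 4 ^ k \<le> j" "j < (4 * l + 1) * 4 ^ k"
          then have j: "j \<in> J1" by (auto simp: J1_def)
          with incr[of j] sub s1[OF j] E1[OF j] e show "U - 4 * real q * d - H1 \<le> g j a' - g j a" by fastforce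
        qed
        moreover have "tmax g k (4 * l + 3) a' - tmax g k (4 * l + 3) a \<le> U - 12 * real q * d + H4"
        proof (rule tmax_increment_le)
          fix j assume "(4 * l + 3) * 4 ^ k \<le> j" "j < (4 * l + 3 + 1) * 4 ^ k"
          then have j: "j \<in> J4" by (auto simp: J4_def)
          with incr[of j] sub s4[OF j] E4[OF j] e show "g j a' - g j a \<le> U - 12 * real q * d + H4" by fastforce
        qed
        ultimately show ?thesis using HH unfolding D_def by linarith
      qed
      moreover have "u + v - 2 * a = d" by (simp add: d_def a'_def)
      ultimately show ?thesis unfolding a'_def[symmetric] by simp
    qed
    \<comment> \<open>A quarter of the slope 8 q is the constant 2 q in
      \<open>piece\<close>.\<close>
    show ?thesis
      using integral_reflect_pair[OF bD bH uv(2) H0 pair] by simp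
  qed
  have finZ: "finite Z" unfolding Z_def by auto
  have "card (Z \<inter> {0<..<1}) \<le> card Z" using finZ by (intro card_mono) auto
  also have "\<dots> \<le> card (y ` {N<..N + 16 * q}) + card ((\<lambda>i. real i / real q) ` {1..<q})"
    unfolding Z_def by (rule card_Un_le)
  also have "\<dots> \<le> card {N<..N + 16 * q} + card {1..<q}" by (intro add_mono card_image_le) auto
  finally have "card (Z \<inter> {0<..<1}) + 1 \<le> 17 * q" using q0 by simp
  then have cardZ: "real (card (Z \<inter> {0<..<1}) + 1) \<le> 17 * real q" by (metis of_nat_le_iff of_nat_mult of_nat_numeral)
  \<comment> \<open>The mean piece length for 17 q pieces; it maximizes the bound.\<close>
  define t where "t = 1 / (17 * real q)"
  have "2 * real q * (2 * t * (1 - 0) - t\<^sup>2 * real (card (Z \<inter> {0<..<1}) + 1)) - integral {0..1} H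
    \<le> integral {0..1} (\<lambda>a. \<bar>D a\<bar>)"
    by (rule integral_piecewise_lower) (use bD bH finZ piece in auto)
  moreover have "2 * real q * (2 * t * (1 - 0) - t\<^sup>2 * (17 * real q)) \<le>
    2 * real q * (2 * t * (1 - 0) - t\<^sup>2 * real (card (Z \<inter> {0<..<1}) + 1))"
    using cardZ by (intro mult_left_mono diff_left_mono) auto
  moreover have "2 * real q * (2 * t * (1 - 0) - t\<^sup>2 * (17 * real q)) = 2 / 17"
    unfolding t_def using q0 by (simp add: field_simps power2_eq_square)
  ultimately show ?thesis using iH unfolding D_def by linarith
qed


lemma sliding_disc_concat:
  "sliding_disc y \<rho> (p * \<tau>) ((p + m) * \<tau>) a = (\<Sum>q<m. sliding_disc y \<rho> ((p + q) * \<tau>) ((p + q + 1) * \<tau>) a)"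
proof (induction m)
  case (Suc m)
  have "{p * \<tau><..(p + Suc m) * \<tau>} = {p * \<tau><..(p + m) * \<tau>} \<union> {(p + m) * \<tau><..(p + m + 1) * \<tau>}"
  proof -
    have "p * \<tau> \<le> (p + m) * \<tau>" "(p + m) * \<tau> \<le> (p + m + 1) * \<tau>" by (intro mult_right_mono; simp)+
    moreover have "p + Suc m = p + m + 1" by simp
    ultimately show ?thesis
      by (intro set_eqI) (simp only: greaterThanAtMost_iff Un_iff, linarith)
  qed
  then have "sliding_disc y \<rho> (p * \<tau>) ((p + Suc m) * \<tau>) a =
    sliding_disc y \<rho> (p * \<tau>) ((p + m) * \<tau>) a + sliding_disc y \<rho> ((p + m) * \<tau>) ((p + m + 1) * \<tau>) a"
    unfolding sliding_disc_def by (simp only:) (rule sum.union_disjoint, auto)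
  then show ?case using Suc by simp
qed (simp add: sliding_disc_def)

text \<open>A leaf consists of \<open>96000 = 16 * 6000\<close> blocks of length \<open>\<tau>\<close>: the grid in \<open>level_gap\<close> has one
  cell per \<open>16\<close> births, and the error \<open>36 / 6000\<close> stays below \<open>2 / 17 - 1 / 9\<close>.\<close>

lemma window_discrepancy_bound:
  assumes y01: "\<And>i. 0 \<le> y i \<and> y i < 1" and e: "e = 1 \<or> e = -1" and s: "0 \<le> s"
    and big: "1000 * real (96000 * 4 ^ \<kappa>) ^ 3 * (s + 1) \<le> \<rho>"
    and bound: "\<And>n a. n0 \<le> n \<Longrightarrow> e * wdisc y \<rho> n a \<le> s"
  shows "real \<kappa> / 18 \<le> s"
proof -
  \<comment> \<open>The b leaves fill the times from b T to 2 b T. In units of \<tau> their blocks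
    have index p with K \<le> p < 2 K, as \<open>sliding_disc_variation\<close> requires.\<close>
  define m b K :: nat where "m = 96000" and "b = 4 ^ \<kappa>" and "K = m * b"
  have m0: "0 < m" and K1: "1 \<le> K" by (auto simp: m_def K_def b_def)
  have \<rho>0: "0 \<le> \<rho>" using big s by (smt (verit) mult_nonneg_nonneg of_nat_0_le_iff zero_le_power)
  \<comment> \<open>All times used lie beyond \<open>n0\<close>, and the last condition gives 52
    \<rho> \<le> \<tau> x even for the smallest x, which belongs to the top level.\<close>
  obtain \<tau> :: nat where \<tau>: "1 \<le> \<tau>" "n0 \<le> \<tau>" "52 * \<rho> * (6000 * 4 ^ \<kappa>) \<le> real \<tau>"
  proof -
    obtain t :: nat where "52 * \<rho> * (6000 * 4 ^ \<kappa>) \<le> real t" using real_arch_simple by blast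
    then show ?thesis using that[of "max (max 1 n0) t"] by (auto simp: max_def split: if_splits)
  qed
  define T where "T = m * \<tau>"
  have T0: "0 < T" using m0 \<tau> by (simp add: T_def)
  define g where "g = leaf e y \<rho> T b"
  have L: "integral {0..1} (\<lambda>a. \<bar>wdisc y \<rho> (p * \<tau>) (a + c)\<bar>) \<le> 2 * s" if "1 \<le> p" for p c
  proof (rule integral_abs_wdisc_le)
    have "n0 \<le> p * \<tau>" by (rule order_trans[OF \<tau>(2)]) (use that in simp)
    then show "e * wdisc y \<rho> (p * \<tau>) a \<le> s" for a by (rule bound)
  qed (use e s in auto)
  have "n0 \<le> (b * m) * \<tau>" by (rule order_trans[OF \<tau>(2)]) (simp add: b_def m_def)
  then have "n0 \<le> b * T" by (simp add: T_def mult.assoc)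
  then have g_le: "g j a \<le> s" for j a unfolding g_def by (intro leaf_le[OF bound _ T0])
  have gap: "1 / 9 \<le> integral {0..1} (\<lambda>a. \<bar>tmax g k (4 * l) a - tmax g k (4 * l + 3) a\<bar>)"
    if k: "k < \<kappa>" and l: "l < 4 ^ (\<kappa> - Suc k)" for k l
  proof -
    \<comment> \<open>With this x the admissible shift x / \<tau> equals the mesh 1 / q, and the 4 ^
      Suc k errors 36 x below a node add up to 36 / 6000 at every level.\<close>
    define x where "x = 1 / (6000 * 4 ^ Suc k :: real)"
    define q where "q = 6000 * 4 ^ Suc k * \<tau>"
    have x: "0 < x" "x \<le> 1"
    proof -
      have "(1::real) \<le> 4 ^ Suc k" by (rule one_le_power) simp
      then have "(1::real) \<le> 6000 * 4 ^ Suc k" by linarith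
      then show "0 < x" "x \<le> 1" unfolding x_def by auto
    qed
    have xq: "x / real \<tau> = 1 / real q" by (simp add: x_def q_def)
    have \<tau>x: "52 * \<rho> \<le> real \<tau> * x"
    proof -
      have "52 * \<rho> * (6000 * 4 ^ Suc k) \<le> 52 * \<rho> * (6000 * 4 ^ \<kappa>)"
        using k \<rho>0 by (intro mult_left_mono power_increasing) auto
      then have "52 * \<rho> * (6000 * 4 ^ Suc k) \<le> real \<tau>" using \<tau> by linarith
      then show ?thesis by (simp add: x_def field_simps)
    qed
    have big': "1000 * real K ^ 3 * (s + 1) \<le> \<rho>" using big by (simp add: K_def m_def b_def)
    define good where "good = (\<lambda>p E. bdd_borel E \<and> (\<forall>a. 0 \<le> E a) \<and> integral {0..1} E \<le> 36 * x \<and>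
      (\<forall>a d. 0 \<le> d \<longrightarrow> d \<le> x / real \<tau> \<longrightarrow>
        \<bar>sliding_disc y \<rho> (p * \<tau>) ((p + 1) * \<tau>) (a + d) - sliding_disc y \<rho> (p * \<tau>) ((p + 1) * \<tau>) a\<bar> \<le> real \<tau> * E a))"
    have "\<exists>E. good p E" if p: "K \<le> p" "p < 2 * K" for p
    proof -
      have "1 \<le> p" "1 \<le> p + 1" "0 < \<tau>" using p K1 \<tau> by auto
      from sliding_disc_variation[OF K1 p this(3) s x big' \<tau>x L[OF this(1)] L[OF this(2)]]
      show ?thesis unfolding good_def by metis
    qed
    then obtain Ef where Ef: "\<And>p. K \<le> p \<Longrightarrow> p < 2 * K \<Longrightarrow> good p (Ef p)" by metis
    define E where "E = (\<lambda>j a. (\<Sum>i<m. Ef (m * (b + j) + i) a) / real m)"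
    have block: "good (m * (b + j) + i) (Ef (m * (b + j) + i))"
      if j: "j < (l + 1) * 4 ^ Suc k" and i: "i < m" for i j
    proof (rule Ef)
      show "K \<le> m * (b + j) + i" by (simp add: K_def algebra_simps)
      have "(l + 1) * 4 ^ Suc k \<le> 4 ^ (\<kappa> - Suc k) * 4 ^ Suc k" using l by (intro mult_right_mono) auto
      also have "\<dots> = b" using k by (simp only: b_def power_add[symmetric]) simp
      finally have "j + 1 \<le> b" using j by simp
      then have "m * (b + (j + 1)) \<le> m * (b + b)" by (intro mult_left_mono) auto
      then show "m * (b + j) + i < 2 * K" using i by (simp add: K_def algebra_simps)
    qed
    have lev: "2 / 17 - 4 ^ Suc k * (36 * x) \<le> integral {0..1} (\<lambda>a. \<bar>tmax g k (4 * l) a - tmax g k (4 * l + 3) a\<bar>)"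
      unfolding g_def
    proof (rule level_gap[OF y01 e T0, of k q l E])
      show "4 ^ Suc k * T = 16 * q" by (simp add: T_def q_def m_def)
    next
      fix j assume j: "l * 4 ^ Suc k \<le> j" "j < (l + 1) * 4 ^ Suc k"
      note bl = block[OF j(2), unfolded good_def]
      show "bdd_borel (E j)" unfolding E_def
        by (intro bdd_borel_divide bdd_borel_sum) (use bl in simp)
      show "0 \<le> E j a" for a unfolding E_def using bl by (intro divide_nonneg_nonneg sum_nonneg) auto
      have "integral {0..1} (\<lambda>a. \<Sum>i<m. Ef (m * (b + j) + i) a) \<le> (\<Sum>i<m. 36 * x)"
        by (rule integral_sum_le) (use bl in auto)
      then show "integral {0..1} (E j) \<le> 36 * x"
        unfolding E_def using m0 by (simp add: field_simps)
      fix a d :: real assume d: "0 \<le> d" "d \<le> 1 / real q"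
      have sp: "sliding_disc y \<rho> ((b + j) * T) ((b + j + 1) * T) a' =
        (\<Sum>i<m. sliding_disc y \<rho> ((m * (b + j) + i) * \<tau>) ((m * (b + j) + i + 1) * \<tau>) a')" for a'
      proof -
        have eqs: "(b + j) * T = m * (b + j) * \<tau>" "(b + j + 1) * T = (m * (b + j) + m) * \<tau>"
          by (simp_all add: T_def algebra_simps)
        show ?thesis unfolding eqs by (rule sliding_disc_concat)
      qed
      have "\<bar>sliding_disc y \<rho> ((b + j) * T) ((b + j + 1) * T) (a + d) - sliding_disc y \<rho> ((b + j) * T) ((b + j + 1) * T) a\<bar>
        \<le> (\<Sum>i<m. \<bar>sliding_disc y \<rho> ((m * (b + j) + i) * \<tau>) ((m * (b + j) + i + 1) * \<tau>) (a + d)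
            - sliding_disc y \<rho> ((m * (b + j) + i) * \<tau>) ((m * (b + j) + i + 1) * \<tau>) a\<bar>)"
        unfolding sp sum_subtractf[symmetric] by (rule sum_abs)
      also have "\<dots> \<le> (\<Sum>i<m. real \<tau> * Ef (m * (b + j) + i) a)"
        using bl d unfolding xq by (intro sum_mono) auto
      also have "\<dots> = real T * E j a"
        unfolding E_def T_def sum_distrib_left[symmetric] using m0 by simp
      finally show "\<bar>sliding_disc y \<rho> ((b + j) * T) ((b + j + 1) * T) (a + d) - sliding_disc y \<rho> ((b + j) * T) ((b + j + 1) * T) a\<bar>
        \<le> real T * E j a" .
    qed
    have "4 ^ Suc k * (36 * x) = 36 / 6000" by (simp add: x_def)
    from lev[unfolded this] show ?thesis by simp
  qed
  have bg: "bdd_borel (g j)" for j unfolding g_def by auto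
  \<comment> \<open>Each of the \<kappa> levels contributes half of the gap 1 / 9, while the maximum
    never exceeds s.\<close>
  have "real \<kappa> * (1 / 9 / 2) \<le> integral {0..1} (tmax g \<kappa> 0)"
    by (rule integral_tmax_ge[OF bg _ gap]) (auto simp: g_def integral_leaf)
  also have "\<dots> \<le> integral {0..1} (\<lambda>a::real. s)"
    by (rule integral_le) (use bg g_le in \<open>auto intro!: tmax_le\<close>)
  finally show ?thesis by simp
qed

section \<open>Spans and windows\<close>

lemma coord_eqD: "coord s = coord t \<Longrightarrow> s = t"
proof (transfer)
  fix s t :: real
  assume "frac s = frac t"
  then have "s - t = of_int (\<lfloor>s\<rfloor> - \<lfloor>t\<rfloor>)" by (simp add: frac_def)
  then show "circle_rel s t" unfolding circle_rel_def by (metis Ints_of_int)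
qed

lemma coord_range: "0 \<le> coord s \<and> coord s < 1"
  by transfer (simp add: frac_lt_1)

context
  fixes x :: "nat \<Rightarrow> circle" and n :: nat
  assumes inj: "inj_on x {1..}" and n: "0 < n"
begin

text \<open>The cut points lifted to the line, one unit being added per turn. The lift removes the
  cyclic wrap-around: an r-span becomes pt (i + r) - pt i for every i.\<close>

definition pt :: "nat \<Rightarrow> real" where
  "pt i = cut_points x n ! (i mod n) + real (i div n)"

lemma finite_cut: "finite (coord ` x ` {1..n})" by simp

lemma set_cut_points: "set (cut_points x n) = (\<lambda>i. coord (x i)) ` {1..n}"
  unfolding cut_points_def using finite_cut by (simp add: image_image)

lemma inj_coord: "inj_on (\<lambda>i. coord (x i)) {1..n}"
proof (rule inj_onI)
  fix i j assume "i \<in> {1..n}" "j \<in> {1..n}" "coord (x i) = coord (x j)"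
  then show "i = j" using inj_onD[OF inj coord_eqD] by auto
qed

lemma length_cut_points: "length (cut_points x n) = n"
proof -
  have "card (coord ` x ` {1..n}) = n"
    using card_image[OF inj_coord] by (simp add: image_image)
  then show ?thesis unfolding cut_points_def by simp
qed

lemma cut_points_less: "i < j \<Longrightarrow> j < n \<Longrightarrow> cut_points x n ! i < cut_points x n ! j"
  using strict_sorted_list_of_set[of "coord ` x ` {1..n}"] length_cut_points
  unfolding cut_points_def by (auto simp: strict_sorted_iff sorted_wrt_nth_less)

lemma cut_points_range: "i < n \<Longrightarrow> 0 \<le> cut_points x n ! i \<and> cut_points x n ! i < 1"
  using nth_mem[of i "cut_points x n"] coord_range unfolding set_cut_points length_cut_points by auto

lemma gap_eq: "gap x n i = pt (Suc i) - pt i"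
proof (cases "Suc (i mod n) < n")
  case True
  then have "Suc i mod n = Suc (i mod n)" "Suc i div n = i div n"
    by (simp_all add: mod_Suc div_Suc)
  then show ?thesis using True by (simp add: gap_def pt_def Let_def)
next
  case False
  then have "Suc (i mod n) = n" using n by (metis Suc_lessI mod_less_divisor)
  then have "Suc i mod n = 0" "Suc i div n = Suc (i div n)"
    by (simp_all add: mod_Suc div_Suc)
  then show ?thesis using False by (simp add: gap_def pt_def Let_def)
qed

lemma span_length_eq: "span_length x r n i = pt (i + r) - pt i"
  unfolding span_length_def gap_eq by (induction r) auto

lemma pt_add_period: "pt (i + q * n) = pt i + real q"
  unfolding pt_def using n by simp

lemma span_length_mod: "span_length x r n (i mod n) = pt (i + r) - pt i"
proof -
  have "i mod n + (i div n) * n = i" by (simp add: mult.commute)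
  then have "pt i = pt (i mod n) + real (i div n)" "pt (i + r) = pt (i mod n + r) + real (i div n)"
    using pt_add_period[of "i mod n" "i div n"] pt_add_period[of "i mod n + r" "i div n"]
    by (simp_all add: ac_simps)
  then show ?thesis unfolding span_length_eq by simp
qed

lemma span_le_max: "pt (i + r) - pt i \<le> max_span x r n"
  unfolding max_span_def span_length_mod[symmetric] using n by (intro Max_ge) auto

lemma min_le_span: "min_span x r n \<le> pt (i + r) - pt i"
  unfolding min_span_def span_length_mod[symmetric] using n by (intro Min_le) auto

text \<open>The n consecutive spans that start at multiples of r run through exactly r
  turns.\<close>

lemma min_span_le_average: "real n * min_span x r n \<le> real r"
proof -
  have "(\<Sum>q<n. min_span x r n) \<le> (\<Sum>q<n. pt (q * r + r) - pt (q * r))"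
    by (intro sum_mono min_le_span)
  also have "\<dots> = pt (n * r) - pt 0"
  proof -
    have "(\<Sum>q<k. pt (q * r + r) - pt (q * r)) = pt (k * r) - pt 0" for k
      by (induction k) (auto simp: add.commute)
    then show ?thesis .
  qed
  also have "\<dots> = real r" using pt_add_period[of 0 r] by (simp add: mult.commute)
  finally show ?thesis by simp
qed

text \<open>A counting function of the lifted points. On [0, 1) it is the number of cut points up to
  a, minus n; hence the - n in \<open>level_pt\<close>.\<close>

definition level :: "real \<Rightarrow> int" where
  "level a = (\<Sum>i=1..n. \<lfloor>a - coord (x i)\<rfloor>)"

lemma cnt_eq_level: "cnt (\<lambda>i. coord (x i)) n a b = level b - level a"
  unfolding cnt_def level_def sum_subtractf ..

lemma level_mono: "a \<le> b \<Longrightarrow> level a \<le> level b"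
  unfolding level_def by (intro sum_mono floor_mono) auto

lemma level_add_int: "level (a + of_int k) = level a + int n * k"
proof -
  have "\<lfloor>a + of_int k - t\<rfloor> = \<lfloor>a - t\<rfloor> + k" for t :: real
    by (metis add.commute add_diff_eq floor_add_int)
  then show ?thesis unfolding level_def by (simp add: sum.distrib)
qed

lemma level_cut_points: "level a = (\<Sum>k<n. \<lfloor>a - cut_points x n ! k\<rfloor>)"
proof -
  have "level a = (\<Sum>z\<in>set (cut_points x n). \<lfloor>a - z\<rfloor>)"
    unfolding level_def set_cut_points by (subst sum.reindex[OF inj_coord]) simp
  also have "\<dots> = sum_list (map (\<lambda>z. \<lfloor>a - z\<rfloor>) (cut_points x n))"
    by (rule sum.distinct_set_conv_list) (simp add: cut_points_def)
  also have "\<dots> = (\<Sum>k<n. \<lfloor>a - cut_points x n ! k\<rfloor>)"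
    by (simp add: sum_list_sum_nth length_cut_points atLeast0LessThan)
  finally show ?thesis .
qed

lemma level_pt: "level (pt i) = int i + 1 - int n"
proof -
  define j q where "j = i mod n" and "q = i div n"
  have j: "j < n" using n by (simp add: j_def)
  have "\<lfloor>pt i - cut_points x n ! k\<rfloor> = int q + (if k \<in> {j<..<n} then -1 else 0)" if k: "k < n" for k
  proof -
    let ?t = "cut_points x n ! j - cut_points x n ! k"
    \<comment> \<open>Two cut points differ by less than 1, so the floor records only their
      order.\<close>
    have "\<lfloor>?t\<rfloor> = (if k \<in> {j<..<n} then -1 else 0)"
    proof (cases "j < k")
      case True
      then show ?thesis using cut_points_less[of j k] cut_points_range[of j] cut_points_range[of k] j k
        by (auto simp: floor_eq_iff)
    next
      case False
      then have "cut_points x n ! k \<le> cut_points x n ! j"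
        using cut_points_less[of k j] j by (cases "k = j") auto
      then show ?thesis using cut_points_range[of j] cut_points_range[of k] j k False
        by (auto simp: floor_eq_iff)
    qed
    moreover have "pt i - cut_points x n ! k = ?t + real_of_int (int q)"
      by (simp add: pt_def j_def q_def)
    then have "\<lfloor>pt i - cut_points x n ! k\<rfloor> = \<lfloor>?t\<rfloor> + int q" by (simp only: floor_add_int)
    ultimately show ?thesis by simp
  qed
  then have "level (pt i) = (\<Sum>k<n. int q + (if k \<in> {j<..<n} then -1 else 0))"
    unfolding level_cut_points by (intro sum.cong) auto
  also have "\<dots> = int n * int q + (\<Sum>k<n. if k \<in> {j<..<n} then -1 else 0)"
    by (simp add: sum.distrib)
  also have "(\<Sum>k<n. if k \<in> {j<..<n} then -1 else 0 :: int) = - int (card {j<..<n})"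
  proof -
    have "{..<n} \<inter> {j<..<n} = {j<..<n}" by auto
    then show ?thesis by (simp add: sum.If_cases del: greaterThanLessThan_iff)
  qed
  also have "int n * int q + - int (card {j<..<n}) = int i + 1 - int n"
  proof -
    have "int i = int n * int q + int j"
      unfolding j_def q_def by (metis mult_div_mod_eq of_nat_add of_nat_mult)
    then show ?thesis using j by (simp add: of_nat_diff)
  qed
  finally show ?thesis .
qed

lemma level_less_pt:
  assumes "a < pt i" shows "level a \<le> int i - int n"
proof -
  define j where "j = i mod n"
  have j: "j < n" using n by (simp add: j_def)
  have "\<lfloor>a - cut_points x n ! j\<rfloor> < \<lfloor>pt i - cut_points x n ! j\<rfloor>"
    using assms by (simp add: pt_def j_def floor_less_iff)
  then have "level a < level (pt i)"
    unfolding level_cut_points using assms j by (intro sum_strict_mono_ex1) (auto intro!: floor_mono)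
  then show ?thesis unfolding level_pt by simp
qed

text \<open>As \<open>pt\<close> has no negative indices, a is first translated by an integer into
  the turn that starts at pt 0.\<close>

lemma between_pt:
  obtains k i where "pt i \<le> a + of_int k" "a + of_int k < pt (Suc i)"
proof -
  define k where "k = - \<lfloor>a - pt 0\<rfloor>"
  have a0: "pt 0 \<le> a + of_int k" unfolding k_def by linarith
  have "a + of_int k < pt (1 * n)" using pt_add_period[of 0 1] unfolding k_def by simp linarith
  then obtain m where m: "a + of_int k < pt m" by blast
  define i where "i = (LEAST i. a + of_int k < pt i)"
  have i: "a + of_int k < pt i" unfolding i_def by (rule LeastI[of _ m]) (rule m)
  then have "i \<noteq> 0" using a0 by (cases i) auto
  then obtain i' where i': "i = Suc i'" by (cases i) auto
  then have "\<not> a + of_int k < pt i'" using not_less_Least[of i' "\<lambda>i. a + of_int k < pt i"] by (simp add: i_def)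
  then show ?thesis using that[of i' k] i i' by simp
qed

text \<open>If, after translation, pt i \<le> a < pt (i + 1), then the r points from pt (i + 1) to
  pt (i + r) all lie in (a, a + w].\<close>

lemma cnt_ge_of_max_span:
  assumes "max_span x r n \<le> w"
  shows "int r \<le> cnt (\<lambda>i. coord (x i)) n a (a + w)"
proof -
  obtain k i where ki: "pt i \<le> a + of_int k" "a + of_int k < pt (Suc i)" by (rule between_pt)
  have "level (a + of_int k) \<le> int (Suc i) - int n" by (rule level_less_pt) (rule ki)
  moreover have "pt (i + r) \<le> a + w + of_int k" using span_le_max[of i r] ki assms by linarith
  then have "level (pt (i + r)) \<le> level (a + w + of_int k)" by (rule level_mono)
  ultimately show ?thesis unfolding cnt_eq_level level_pt level_add_int by simp
qed

text \<open>In the same position pt (i + 1 + r) lies beyond a + w, which leaves at most r points for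
  the window.\<close>

lemma cnt_le_of_min_span:
  assumes "w \<le> min_span x r n"
  shows "cnt (\<lambda>i. coord (x i)) n a (a + w) \<le> int r"
proof -
  obtain k i where ki: "pt i \<le> a + of_int k" "a + of_int k < pt (Suc i)" by (rule between_pt)
  have "level (pt i) \<le> level (a + of_int k)" by (rule level_mono) (rule ki)
  moreover have "a + w + of_int k < pt (Suc i + r)" using min_le_span[of r "Suc i"] ki assms by linarith
  then have "level (a + w + of_int k) \<le> int (Suc i + r) - int n" by (rule level_less_pt)
  ultimately show ?thesis unfolding cnt_eq_level level_pt level_add_int by simp
qed

lemma min_span_pos:
  assumes "0 < r" shows "0 < min_span x r n"
proof -
  have "pt i < pt (i + r)" for i
    using level_mono[of "pt (i + r)" "pt i"] assms unfolding level_pt by force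
  then have "\<forall>z\<in>span_length x r n ` {..<n}. 0 < z" by (auto simp: span_length_eq)
  then show ?thesis unfolding min_span_def using n by (subst Min_gr_iff) auto
qed

end

section \<open>Choice of parameters and conclusion\<close>

lemma le_limsup_of_frequently:
  assumes "\<exists>\<^sub>F n in sequentially. C \<le> f n"
  shows "ereal C \<le> limsup (\<lambda>n. ereal (f n))"
proof (rule ccontr)
  assume "\<not> ?thesis"
  then have "\<forall>\<^sub>F n in sequentially. ereal (f n) < ereal C" by (intro Limsup_lessD) auto
  then have "\<forall>\<^sub>F n in sequentially. \<not> C \<le> f n" by eventually_elim auto
  with assms show False unfolding frequently_def by blast
qed

text \<open>Take \<kappa> about ln r / 5. The cube of 4 ^ \<kappa> is then at most r powr 0.84,
  since 3 ln 4 / 5 < 0.84, and this exponent below 1 leaves room for the constants and the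
  logarithm. On the other side \<kappa> / 18 is about ln r / 90, which exceeds ln r / 100 for large
  r.\<close>

lemma parameters_exist:
  "\<exists>r0::nat. \<forall>r\<ge>r0. \<exists>\<kappa>::nat. 1 \<le> ln (real r) \<and> ln (real r) / 100 < real \<kappa> / 18 \<and>
    1000 * real (96000 * 4 ^ \<kappa>) ^ 3 * (ln (real r) / 100 + 1) \<le> real r - ln (real r) / 100"
proof -
  have "\<forall>\<^sub>F r::real in at_top. 1 \<le> ln r \<and> ln r / 100 < (ln r / 5 - 1) / 18 \<and>
     1000 * 96000 ^ 3 * (r powr 0.84) * (ln r / 100 + 1) \<le> r - ln r / 100"
    by (intro eventually_conj; real_asymp)
  then have "\<forall>\<^sub>F r in sequentially. 1 \<le> ln (real r) \<and> ln (real r) / 100 < (ln (real r) / 5 - 1) / 18 \<and>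
     1000 * 96000 ^ 3 * (real r powr 0.84) * (ln (real r) / 100 + 1) \<le> real r - ln (real r) / 100"
    by (rule eventually_compose_filterlim[OF _ filterlim_real_sequentially])
  then obtain r0 where r0: "\<And>r. r \<ge> r0 \<Longrightarrow> 1 \<le> ln (real r) \<and> ln (real r) / 100 < (ln (real r) / 5 - 1) / 18 \<and>
     1000 * 96000 ^ 3 * (real r powr 0.84) * (ln (real r) / 100 + 1) \<le> real r - ln (real r) / 100"
    unfolding eventually_sequentially by blast
  have "\<exists>\<kappa>::nat. 1 \<le> ln (real r) \<and> ln (real r) / 100 < real \<kappa> / 18 \<and>
    1000 * real (96000 * 4 ^ \<kappa>) ^ 3 * (ln (real r) / 100 + 1) \<le> real r - ln (real r) / 100" if "r \<ge> r0" for r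
  proof -
    define L where "L = ln (real r)"
    have L: "1 \<le> L" "L / 100 < (L / 5 - 1) / 18"
      "1000 * 96000 ^ 3 * (real r powr 0.84) * (L / 100 + 1) \<le> real r - L / 100"
      using r0[OF that] unfolding L_def by auto
    have rpos: "0 < real r" using L(1) unfolding L_def by (cases "r = 0") auto
    define \<kappa> where "\<kappa> = nat \<lfloor>L / 5\<rfloor>"
    have \<kappa>: "real \<kappa> \<le> L / 5" "L / 5 - 1 < real \<kappa>" using L(1) unfolding \<kappa>_def by linarith+
    have ln4: "ln (4::real) \<le> 1.4"
    proof -
      have "ln (4::real) = 2 * ln 2" using ln_realpow[of 2 2] by simp
      then show ?thesis using ln2_le_25_over_36 by simp
    qed
    have "(4::real) ^ \<kappa> = exp (real \<kappa> * ln 4)" by (simp add: exp_of_nat_mult)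
    also have "\<dots> \<le> exp (L / 5 * 1.4)" using \<kappa> ln4 L(1) by (intro iffD2[OF exp_le_cancel_iff] mult_mono) auto
    finally have "(4::real) ^ \<kappa> \<le> exp (0.28 * L)" by (simp add: mult.commute)
    then have "((4::real) ^ \<kappa>) ^ 3 \<le> exp (0.28 * L) ^ 3" by (intro power_mono) auto
    also have "exp (0.28 * L) ^ 3 = exp (real 3 * (0.28 * L))" by (rule exp_of_nat_mult[symmetric])
    also have "real 3 * (0.28 * L) = 0.84 * L" by simp
    also have "exp (0.84 * L) = real r powr 0.84" using rpos by (simp add: powr_def L_def)
    finally have four: "((4::real) ^ \<kappa>) ^ 3 \<le> real r powr 0.84" .
    have "1000 * real (96000 * 4 ^ \<kappa>) ^ 3 * (L / 100 + 1) = 1000 * 96000 ^ 3 * ((4::real) ^ \<kappa>) ^ 3 * (L / 100 + 1)"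
      by (simp add: power_mult_distrib)
    also have "\<dots> \<le> 1000 * 96000 ^ 3 * (real r powr 0.84) * (L / 100 + 1)"
      using four L(1) by (intro mult_right_mono mult_left_mono) auto
    also have "\<dots> \<le> real r - L / 100" by (rule L(3))
    finally have "1000 * real (96000 * 4 ^ \<kappa>) ^ 3 * (L / 100 + 1) \<le> real r - L / 100" .
    moreover have "L / 100 < real \<kappa> / 18" using L(2) \<kappa>(2) by simp
    ultimately show ?thesis using L(1) unfolding L_def[symmetric] by blast
  qed
  then show ?thesis by blast
qed

theorem theorem1p1:
  "\<exists>c::real. c > 0 \<and> (\<exists>r0::nat. r0 \<ge> 1 \<and>
    (\<forall>r::nat. r \<ge> r0 \<longrightarrow> (\<forall>x :: nat \<Rightarrow> circle. inj_on x {1..} \<longrightarrow>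
      limsup (\<lambda>n. ereal (real n * max_span x r n - real r)) \<ge> ereal (c * sqrt (ln (real r))) \<and>
      limsup (\<lambda>n. ereal (real r - real n * min_span x r n)) \<ge> ereal (c * sqrt (ln (real r))) \<and>
      limsup (\<lambda>n. ereal (max_span x r n / min_span x r n))
        \<ge> ereal (1 + ln (real r) / (100 * real r)))))"
proof -
  obtain r0 :: nat where r0: "\<And>r. r \<ge> r0 \<Longrightarrow> \<exists>\<kappa>::nat. 1 \<le> ln (real r) \<and> ln (real r) / 100 < real \<kappa> / 18 \<and>
    1000 * real (96000 * 4 ^ \<kappa>) ^ 3 * (ln (real r) / 100 + 1) \<le> real r - ln (real r) / 100"
    using parameters_exist by blast
  have main: "limsup (\<lambda>n. ereal (real n * max_span x r n - real r)) \<ge> ereal (1/100 * sqrt (ln (real r))) \<and>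
      limsup (\<lambda>n. ereal (real r - real n * min_span x r n)) \<ge> ereal (1/100 * sqrt (ln (real r))) \<and>
      limsup (\<lambda>n. ereal (max_span x r n / min_span x r n)) \<ge> ereal (1 + ln (real r) / (100 * real r))"
    if r: "r \<ge> max r0 1" and inj: "inj_on x {1..}" for r and x :: "nat \<Rightarrow> circle"
  proof -
    define s where "s = ln (real r) / 100"
    define y where "y = (\<lambda>i. coord (x i))"
    obtain \<kappa> :: nat where \<kappa>: "1 \<le> ln (real r)" "s < real \<kappa> / 18"
      "1000 * real (96000 * 4 ^ \<kappa>) ^ 3 * (s + 1) \<le> real r - s"
      using r0[of r] r unfolding s_def by auto
    have r1: "0 < r" using r by simp
    have s0: "0 \<le> s" using \<kappa>(1) by (simp add: s_def)
    have y01: "0 \<le> y i \<and> y i < 1" for i unfolding y_def by (rule coord_range)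
    \<comment> \<open>The argument yields the order ln r; this dominates the square root because ln
      r \<ge> 1.\<close>
    have sqrt_le: "1/100 * sqrt (ln (real r)) \<le> s"
    proof -
      have "sqrt (ln (real r)) * 1 \<le> sqrt (ln (real r)) * sqrt (ln (real r))"
        using \<kappa>(1) by (intro mult_left_mono) auto
      then show ?thesis using \<kappa>(1) by (simp add: s_def)
    qed
    have max_freq: "\<exists>\<^sub>F n in sequentially. s < real n * max_span x r n - real r"
    proof (rule ccontr)
      assume "\<not> ?thesis"
      then obtain n0 where n0: "\<And>n. n0 \<le> n \<Longrightarrow> real n * max_span x r n - real r \<le> s"
        unfolding not_frequently eventually_sequentially by (auto simp: not_less)
      \<comment> \<open>Windows of length (r + s) / n would always hold at least r points where r +
        s are expected, so - \<open>wdisc\<close> would be at most s. Starting from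
        \<open>max n0 1\<close> excludes n = 0.\<close>
      have "real \<kappa> / 18 \<le> s"
      proof (rule window_discrepancy_bound[OF y01 _ s0, where e = "-1" and \<rho> = "real r + s" and ?n0.0 = "max n0 1"])
        show "1000 * real (96000 * 4 ^ \<kappa>) ^ 3 * (s + 1) \<le> real r + s" using \<kappa>(3) s0 by linarith
        fix n a assume n: "max n0 1 \<le> n"
        then have n1: "0 < n" by simp
        have "max_span x r n \<le> (real r + s) / real n"
          using n0[of n] n n1 by (simp add: field_simps)
        from cnt_ge_of_max_span[OF inj n1 this, of a]
        have "real r \<le> of_int (cnt y n a (a + (real r + s) / real n))" unfolding y_def by linarith
        then show "-1 * wdisc y (real r + s) n a \<le> s"
          unfolding wdisc_def disc_diff using n1 by simp
      qed simp
      with \<kappa>(2) show False by simp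
    qed
    have min_freq: "\<exists>\<^sub>F n in sequentially. s < real r - real n * min_span x r n"
    proof (rule ccontr)
      assume "\<not> ?thesis"
      then obtain n0 where n0: "\<And>n. n0 \<le> n \<Longrightarrow> real r - real n * min_span x r n \<le> s"
        unfolding not_frequently eventually_sequentially by (auto simp: not_less)
      \<comment> \<open>Dually, windows of length (r - s) / n would hold at most r points where r -
        s are expected.\<close>
      have "real \<kappa> / 18 \<le> s"
      proof (rule window_discrepancy_bound[OF y01 _ s0 \<kappa>(3), where e = 1 and ?n0.0 = "max n0 1"])
        fix n a assume n: "max n0 1 \<le> n"
        then have n1: "0 < n" by simp
        have "(real r - s) / real n \<le> min_span x r n"
          using n0[of n] n n1 by (simp add: field_simps)
        from cnt_le_of_min_span[OF inj n1 this, of a]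
        have "of_int (cnt y n a (a + (real r - s) / real n)) \<le> real r" unfolding y_def by linarith
        then show "1 * wdisc y (real r - s) n a \<le> s"
          unfolding wdisc_def disc_diff using n1 by simp
      qed simp
      with \<kappa>(2) show False by simp
    qed
    have ratio: "1 + ln (real r) / (100 * real r) \<le> max_span x r n / min_span x r n"
      if "s < real n * max_span x r n - real r" for n
    proof -
      \<comment> \<open>At n = 0 the assumption would read s < - r.\<close>
      have n1: "0 < n" using that s0 r1 by (cases n) auto
      have m: "0 < min_span x r n" "real n * min_span x r n \<le> real r"
        using min_span_pos[OF inj n1 r1] min_span_le_average[OF inj n1] by auto
      have "1 + ln (real r) / (100 * real r) = (real r + s) / real r"
        using r1 by (simp add: s_def field_simps)
      also have "\<dots> \<le> (real r + s) / (real n * min_span x r n)"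
        using m n1 r1 s0 by (intro divide_left_mono) auto
      also have "\<dots> \<le> (real n * max_span x r n) / (real n * min_span x r n)"
        using that m n1 by (intro divide_right_mono) auto
      also have "\<dots> = max_span x r n / min_span x r n" using n1 by simp
      finally show ?thesis .
    qed
    show ?thesis
      by (intro conjI le_limsup_of_frequently
          frequently_elim1[OF max_freq] frequently_elim1[OF min_freq])
        (use sqrt_le ratio in auto)
  qed
  show ?thesis
    by (rule exI[of _ "1/100"], intro conjI exI[of _ "max r0 1"]) (use main in auto)
qed

end
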